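(* Let $\Phi,\Psi$ be stationary random measures on $\mathbb R^d$ (on the same probability space) which are almost surely non-zero and have finite intensities. Let $F:\Omega\times\mathbb R^d\times\mathbb R^d\to[0,\infty)$ be measurable and flow-adapted such that $F_\omega$ is a stable constrained density for $(\Phi_\omega,\Psi_\omega)$. Then almost surely: (i) $\Phi_\omega$-almost every site and $\Psi_\omega$-almost every center has a bounded territory; (ii) for every bounded set $K\subseteq\mathbb R^d$, the union of the territories of the sites in $K$ has finite $\Psi_\omega$-measure, and the union of the territories of the centers in $K$ has finite $\Phi_\omega$-measure.
   Context: Random setup: measurable space $(\Omega,\mathcal F)$ with measurable flow $(\theta_s)_{s\in\mathbb R^d}$ ($(\omega,s)\mapsto\theta_s\omega$ measurable, $\theta_0=\mathrm{id}$, $\theta_s\theta_t=\theta_{s+t}$) and probability $\mathbb P$. Shifts act on measures by $(\theta_s\mu)(B)=\mu(B+s)$ and on functions of two variables by $(\theta_sf)(x,y)=f(x+s,y+s)$; $G$ is flow-adapted if $G(\theta_s\omega)=\theta_sG(\omega)$. A random measure is a measurable $\Phi:\Omega\to M$ ($M$: non-negative locally finite Borel measures on $\mathbb R^d$); stationary if $\mathbb P$ is invariant under all $\theta_s$ and $\Phi$ is flow-adapted. Intensity $\lambda$: $\mathbb E\Phi(B)=\lambda\mathcal L_d(B)$. Densities and stability for $(\varphi,\psi)$: a non-negative measurable $f$ is a constrained density if $\int f(x,\xi)\psi(d\xi)\le1$ for all $x$, $\int f(x,\xi)\varphi(dx)\le1$ for all $\xi$, and $f\le 1$. A site $x_0$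 is exhausted if $\int f(x_0,\xi)\psi(d\xi)=1$, else unexhausted; a center $\xi_0$ is sated if $\int f(x,\xi_0)\varphi(dx)=1$, else unsated. $x_0$ desires $\xi_0$ if $f(x_0,\xi_0)<1$ and either $x_0$ is unexhausted or some $\xi_1$ has $|x_0-\xi_1|>|x_0-\xi_0|$ and $f(x_0,\xi_1)>0$. $\xi_0$ desires $x_0$ if $f(x_0,\xi_0)<1$ and either $\xi_0$ is unsated or some $x_1$ has $|x_1-\xi_0|>|x_0-\xi_0|$ and $f(x_1,\xi_0)>0$. $f$ is stable if no pair desires each other. Territories: the territory of a site $x$ is $\{\xi:F_\omega(x,\xi)>0\}$, and that of a center $\xi$ is $\{x:F_\omega(x,\xi)>0\}$. *)

theory Defs
  imports "HOL-Probability.Probability"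
begin

definition measurable_flow :: "'w measure \<Rightarrow> ('d::euclidean_space \<Rightarrow> 'w \<Rightarrow> 'w) \<Rightarrow> bool" where
  "measurable_flow P \<theta> \<longleftrightarrow>
     (\<lambda>(\<omega>, s). \<theta> s \<omega>) \<in> measurable (P \<Otimes>\<^sub>M borel) P \<and>
     (\<forall>\<omega>\<in>space P. \<theta> 0 \<omega> = \<omega>) \<and>
     (\<forall>s t. \<forall>\<omega>\<in>space P. \<theta> s (\<theta> t \<omega>) = \<theta> (s + t) \<omega>)"

definition flow_invariant :: "'w measure \<Rightarrow> ('d::euclidean_space \<Rightarrow> 'w \<Rightarrow> 'w) \<Rightarrow> bool" where
  "flow_invariant P \<theta> \<longleftrightarrow> (\<forall>s. distr P P (\<theta> s) = P)"

definition locally_finite_borel :: "'d::euclidean_space measure \<Rightarrow> bool" where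
  "locally_finite_borel \<mu> \<longleftrightarrow> sets \<mu> = sets borel \<and> (\<forall>K. compact K \<longrightarrow> emeasure \<mu> K < \<infinity>)"

text \<open>Random measure: measurable map into the locally finite measures (measurability
  w.r.t. the evaluation sigma-algebra).\<close>
definition random_measure :: "'w measure \<Rightarrow> ('w \<Rightarrow> 'd::euclidean_space measure) \<Rightarrow> bool" where
  "random_measure P \<Phi> \<longleftrightarrow>
     (\<forall>\<omega>\<in>space P. locally_finite_borel (\<Phi> \<omega>)) \<and>
     (\<forall>B\<in>sets borel. (\<lambda>\<omega>. emeasure (\<Phi> \<omega>) B) \<in> borel_measurable P)"

text \<open>Stationary random measure: P flow-invariant and \<Phi> flow-adapted,
  where (\<theta>_s \<mu>)(B) = \<mu>(B + s).\<close>
definition stationary_random_measure ::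
  "'w measure \<Rightarrow> ('d::euclidean_space \<Rightarrow> 'w \<Rightarrow> 'w) \<Rightarrow> ('w \<Rightarrow> 'd measure) \<Rightarrow> bool" where
  "stationary_random_measure P \<theta> \<Phi> \<longleftrightarrow>
     random_measure P \<Phi> \<and> flow_invariant P \<theta> \<and>
     (\<forall>s. \<forall>\<omega>\<in>space P. \<forall>B\<in>sets borel.
        emeasure (\<Phi> (\<theta> s \<omega>)) B = emeasure (\<Phi> \<omega>) ((\<lambda>x. x + s) ` B))"

definition finite_intensity :: "'w measure \<Rightarrow> ('w \<Rightarrow> 'd::euclidean_space measure) \<Rightarrow> bool" where
  "finite_intensity P \<Phi> \<longleftrightarrow>
     (\<exists>lam::real. lam \<ge> 0 \<and>
        (\<forall>B\<in>sets borel. (\<integral>\<^sup>+\<omega>. emeasure (\<Phi> \<omega>) B \<partial>P) = ennreal lam * emeasure lborel B))"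

definition constrained_density ::
  "'d::euclidean_space measure \<Rightarrow> 'd measure \<Rightarrow> ('d \<Rightarrow> 'd \<Rightarrow> real) \<Rightarrow> bool" where
  "constrained_density \<phi> \<psi> f \<longleftrightarrow>
     (\<lambda>(x, y). f x y) \<in> borel_measurable (borel \<Otimes>\<^sub>M borel) \<and>
     (\<forall>x y. 0 \<le> f x y \<and> f x y \<le> 1) \<and>
     (\<forall>x. (\<integral>\<^sup>+\<xi>. ennreal (f x \<xi>) \<partial>\<psi>) \<le> 1) \<and>
     (\<forall>\<xi>. (\<integral>\<^sup>+x. ennreal (f x \<xi>) \<partial>\<phi>) \<le> 1)"

definition exhausted :: "'d::euclidean_space measure \<Rightarrow> ('d \<Rightarrow> 'd \<Rightarrow> real) \<Rightarrow> 'd \<Rightarrow> bool" where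
  "exhausted \<psi> f x \<longleftrightarrow> (\<integral>\<^sup>+\<xi>. ennreal (f x \<xi>) \<partial>\<psi>) = 1"

definition sated :: "'d::euclidean_space measure \<Rightarrow> ('d \<Rightarrow> 'd \<Rightarrow> real) \<Rightarrow> 'd \<Rightarrow> bool" where
  "sated \<phi> f \<xi> \<longleftrightarrow> (\<integral>\<^sup>+x. ennreal (f x \<xi>) \<partial>\<phi>) = 1"

definition site_desires ::
  "'d::euclidean_space measure \<Rightarrow> ('d \<Rightarrow> 'd \<Rightarrow> real) \<Rightarrow> 'd \<Rightarrow> 'd \<Rightarrow> bool" where
  "site_desires \<psi> f x0 \<xi>0 \<longleftrightarrow> f x0 \<xi>0 < 1 \<and>
     (\<not> exhausted \<psi> f x0 \<or> (\<exists>\<xi>1. dist x0 \<xi>1 > dist x0 \<xi>0 \<and> f x0 \<xi>1 > 0))"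

definition center_desires ::
  "'d::euclidean_space measure \<Rightarrow> ('d \<Rightarrow> 'd \<Rightarrow> real) \<Rightarrow> 'd \<Rightarrow> 'd \<Rightarrow> bool" where
  "center_desires \<phi> f \<xi>0 x0 \<longleftrightarrow> f x0 \<xi>0 < 1 \<and>
     (\<not> sated \<phi> f \<xi>0 \<or> (\<exists>x1. dist x1 \<xi>0 > dist x0 \<xi>0 \<and> f x1 \<xi>0 > 0))"

definition stable ::
  "'d::euclidean_space measure \<Rightarrow> 'd measure \<Rightarrow> ('d \<Rightarrow> 'd \<Rightarrow> real) \<Rightarrow> bool" where
  "stable \<phi> \<psi> f \<longleftrightarrow> \<not> (\<exists>x \<xi>. site_desires \<psi> f x \<xi> \<and> center_desires \<phi> f \<xi> x)"

definition site_territory :: "('d \<Rightarrow> 'd \<Rightarrow> real) \<Rightarrow> 'd \<Rightarrow> 'd set" where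
  "site_territory f x = {\<xi>. f x \<xi> > 0}"

definition center_territory :: "('d \<Rightarrow> 'd \<Rightarrow> real) \<Rightarrow> 'd \<Rightarrow> 'd set" where
  "center_territory f \<xi> = {x. f x \<xi> > 0}"

definition finite_outer :: "'d::euclidean_space measure \<Rightarrow> 'd set \<Rightarrow> bool" where
  "finite_outer \<mu> S \<longleftrightarrow> (\<exists>B\<in>sets \<mu>. S \<subseteq> B \<and> emeasure \<mu> B < \<infinity>)"

end

theory Submission
  imports Defs
begin

text \<open>A site with unbounded territory desires every center, up to those it already serves fully, a set
  of mass at most 1. By stability those other centers send nothing beyond their distance to it. If
  such sites occur at all, then by Poincare recurrence along the lattice directions they occur, with
  infinite mass, arbitrarily far out in each of the \<open>2d\<close> cones around the signed basis vectors. A far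
  center \<open>\<xi>\<close> in the territory of a given site \<open>x\<close> lies in one of these cones and has many of them
  nearer than \<open>x\<close>. All of them must serve \<open>\<xi>\<close> fully, which exceeds its capacity 1.

  For the territory of a bounded set \<open>K\<close>, unbounded sites are replaced by sequences of sites in a fixed
  ball with partners escaping to infinity: if some ball has such a sequence, recurrence puts such
  balls into every cone, and all but a bounded part of the territory of \<open>K\<close> consists of centers that
  almost all members of one of \<open>2d\<close> sequences serve fully, a set of mass at most \<open>2d\<close>.

  The sets to which recurrence is applied are projections of measurable sets, since territories are
  taken pointwise and not up to null sets. They are measurable only with respect to the completion.\<close>

subsection \<open>Measurable projection\<close>

text \<open>Souslin sets in a form that is closed under countable unions and intersections by mere reindexing:
  the second coordinate is governed by a single closed set, the first one by sets depending on
  finitely many entries of the parameter.\<close>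
definition souslin :: "'a measure \<Rightarrow> ('a \<times> 'y::euclidean_space) set \<Rightarrow> bool" where
  "souslin M S \<longleftrightarrow> (\<exists>(C :: ('y \<times> (nat \<Rightarrow> nat)) set) (A :: nat \<Rightarrow> (nat \<Rightarrow> nat) \<Rightarrow> 'a set).
     closed C \<and> (\<forall>n \<sigma>. A n \<sigma> \<in> sets M) \<and>
     (\<forall>n \<sigma> \<tau>. (\<forall>i<n. \<sigma> i = \<tau> i) \<longrightarrow> A n \<sigma> = A n \<tau>) \<and>
     S = {(\<omega>, y). \<exists>\<sigma>. (y, \<sigma>) \<in> C \<and> (\<forall>n. \<omega> \<in> A n \<sigma>)})"

section \<open>Closure properties of Souslin sets\<close>

lemma souslinI:
  fixes C :: "('y::euclidean_space \<times> (nat \<Rightarrow> nat)) set"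
  assumes "closed C" "\<And>n \<sigma>. A n \<sigma> \<in> sets M"
    and "\<And>n \<sigma> \<tau>. (\<And>i. i < n \<Longrightarrow> \<sigma> i = \<tau> i) \<Longrightarrow> A n \<sigma> = A n \<tau>"
    and "\<And>\<omega> y. (\<omega>, y) \<in> S \<longleftrightarrow> (\<exists>\<sigma>. (y, \<sigma>) \<in> C \<and> (\<forall>n. \<omega> \<in> A n \<sigma>))"
  shows "souslin M S"
proof -
  have "S = {(\<omega>, y). \<exists>\<sigma>. (y, \<sigma>) \<in> C \<and> (\<forall>n. \<omega> \<in> A n \<sigma>)}"
    using assms(4) by auto
  then show ?thesis
    unfolding souslin_def using assms(1-3) by (intro exI[of _ C] exI[of _ A] conjI allI impI) blast+
qed

lemma souslin_closed_rectangle: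
  assumes "A \<in> sets M" "closed C"
  shows "souslin M (A \<times> C)"
  by (rule souslinI[where C = "C \<times> UNIV" and A = "\<lambda>_ _. A"])
    (use assms in \<open>auto intro: closed_Times\<close>)

text \<open>Countable choice of representations, so that the closure proofs below can work with all
  members of a sequence at once.\<close>

lemma souslin_sequence:
  fixes S :: "nat \<Rightarrow> ('a \<times> 'y::euclidean_space) set"
  assumes "\<And>m. souslin M (S m)"
  shows "\<exists>(C :: nat \<Rightarrow> ('y \<times> (nat \<Rightarrow> nat)) set) A. \<forall>m. closed (C m) \<and> (\<forall>n \<sigma>. A m n \<sigma> \<in> sets M) \<and>
      (\<forall>n \<sigma> \<tau>. (\<forall>i<n. \<sigma> i = \<tau> i) \<longrightarrow> A m n \<sigma> = A m n \<tau>) \<and>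
      S m = {(\<omega>, y). \<exists>\<sigma>. (y, \<sigma>) \<in> C m \<and> (\<forall>n. \<omega> \<in> A m n \<sigma>)}"
proof -
  have "\<forall>m. \<exists>(C :: ('y \<times> (nat \<Rightarrow> nat)) set) A. closed C \<and> (\<forall>n \<sigma>. A n \<sigma> \<in> sets M) \<and>
      (\<forall>n \<sigma> \<tau>. (\<forall>i<n. \<sigma> i = \<tau> i) \<longrightarrow> A n \<sigma> = A n \<tau>) \<and>
      S m = {(\<omega>, y). \<exists>\<sigma>. (y, \<sigma>) \<in> C \<and> (\<forall>n. \<omega> \<in> A n \<sigma>)}"
    by (rule allI) (rule assms[unfolded souslin_def])
  from choice[OF this] obtain C :: "nat \<Rightarrow> ('y \<times> (nat \<Rightarrow> nat)) set" where
    "\<forall>m. \<exists>A. closed (C m) \<and> (\<forall>n \<sigma>. A n \<sigma> \<in> sets M) \<and>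
      (\<forall>n \<sigma> \<tau>. (\<forall>i<n. \<sigma> i = \<tau> i) \<longrightarrow> A n \<sigma> = A n \<tau>) \<and>
      S m = {(\<omega>, y). \<exists>\<sigma>. (y, \<sigma>) \<in> C m \<and> (\<forall>n. \<omega> \<in> A n \<sigma>)}" ..
  from choice[OF this] show ?thesis
    by (rule exI[of _ C])
qed

lemma continuous_on_snd_apply:
  "continuous_on UNIV (\<lambda>z :: 'y::topological_space \<times> (nat \<Rightarrow> nat). snd z i)"
  by (rule continuous_on_product_then_coordinatewise[OF continuous_on_snd[OF continuous_on_id]])

text \<open>Selecting entries of the parameter is continuous for the product topology. This lets one
  parameter carry the parameters of several sets.\<close>

lemma closed_reindex:
  fixes C :: "('y::topological_space \<times> (nat \<Rightarrow> nat)) set"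
  assumes "closed C"
  shows "closed {z. (fst z, \<lambda>k. snd z (r k :: nat)) \<in> C}"
proof -
  have "continuous_on UNIV (\<lambda>z :: 'y \<times> (nat \<Rightarrow> nat). \<lambda>k :: nat. snd z (r k))"
    by (rule continuous_on_coordinatewise_then_product) (rule continuous_on_snd_apply)
  then have "continuous_on UNIV (\<lambda>z :: 'y \<times> (nat \<Rightarrow> nat). (fst z, \<lambda>k. snd z (r k)))"
    by (rule continuous_on_Pair[OF continuous_on_fst[OF continuous_on_id]])
  then have "closed ((\<lambda>z :: 'y \<times> (nat \<Rightarrow> nat). (fst z, \<lambda>k. snd z (r k))) -` C)"
    using assms by (rule closed_vimage[rotated])
  then show ?thesis by (simp add: vimage_def)
qed

text \<open>Entry 0 of the new parameter names a member of the union, and the remaining entries are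
  a parameter for that member.\<close>

lemma souslin_UN:
  fixes S :: "nat \<Rightarrow> ('a \<times> 'y::euclidean_space) set"
  assumes "\<And>m. souslin M (S m)"
  shows "souslin M (\<Union>m. S m)"
proof -
  obtain C :: "nat \<Rightarrow> ('y \<times> (nat \<Rightarrow> nat)) set" and A where
    *: "\<forall>m. closed (C m) \<and> (\<forall>n \<sigma>. A m n \<sigma> \<in> sets M) \<and>
      (\<forall>n \<sigma> \<tau>. (\<forall>i<n. \<sigma> i = \<tau> i) \<longrightarrow> A m n \<sigma> = A m n \<tau>) \<and>
      S m = {(\<omega>, y). \<exists>\<sigma>. (y, \<sigma>) \<in> C m \<and> (\<forall>n. \<omega> \<in> A m n \<sigma>)}"
    using souslin_sequence[of M S, OF assms] by (elim exE)
  have C: "closed (C m)" and A: "A m n \<sigma> \<in> sets M"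
    and dep: "(\<And>i. i < n \<Longrightarrow> \<sigma> i = \<tau> i) \<Longrightarrow> A m n \<sigma> = A m n \<tau>"
    and S: "S m = {(\<omega>, y). \<exists>\<sigma>. (y, \<sigma>) \<in> C m \<and> (\<forall>n. \<omega> \<in> A m n \<sigma>)}" for m n \<sigma> \<tau>
    using spec[OF *, of m] by blast+
  \<comment> \<open>The condition that the tail lies in \<open>C (snd z 0)\<close>, written as an
    intersection over \<open>m\<close> so that closedness is visible:
    \<open>snd z 0 \<noteq> m\<close> is a clopen condition because \<open>nat\<close> is
    discrete.\<close>
  define C' where "C' = (\<Inter>m. {z. snd z 0 \<noteq> m} \<union> {z. (fst z, \<lambda>k. snd z (Suc k)) \<in> C m})"
  \<comment> \<open>Stages are shifted by one: at stage 0 no entry may be read, so the index of the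
    member is still unknown and the whole space is the only choice.\<close>
  define A' where
    "A' = (\<lambda>n \<sigma>. case n of 0 \<Rightarrow> space M | Suc n \<Rightarrow> A (\<sigma> 0) n (\<lambda>k. \<sigma> (Suc k)))"
  show ?thesis
  proof (rule souslinI[where C = C' and A = A'])
    have "closed {z :: 'y \<times> (nat \<Rightarrow> nat). snd z 0 \<noteq> m}" for m
    proof -
      have "closed ((\<lambda>z :: 'y \<times> (nat \<Rightarrow> nat). snd z 0) -` (- {m}))"
        by (intro closed_vimage continuous_on_snd_apply) (simp add: closed_def discrete_topology_class.open_discrete)
      then show ?thesis by (simp add: vimage_def)
    qed
    then show "closed C'"
      unfolding C'_def by (intro closed_INT ballI closed_Un closed_reindex C)
    show "A' n \<sigma> \<in> sets M" for n \<sigma>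
      using A by (simp add: A'_def split: nat.split)
    show "A' n \<sigma> = A' n \<tau>" if "\<And>i. i < n \<Longrightarrow> \<sigma> i = \<tau> i" for n \<sigma> \<tau>
    proof (cases n)
      case (Suc k)
      have "A (\<tau> 0) k (\<lambda>k. \<sigma> (Suc k)) = A (\<tau> 0) k (\<lambda>k. \<tau> (Suc k))"
        by (rule dep) (simp add: that Suc)
      moreover have "\<sigma> 0 = \<tau> 0" using that Suc by blast
      ultimately show ?thesis using Suc by (simp add: A'_def)
    qed (simp add: A'_def)
    have sp: "\<forall>n. \<omega> \<in> A m n \<sigma> \<Longrightarrow> \<omega> \<in> space M" for \<omega> m \<sigma>
      using sets.sets_into_space[OF A] by blast
    show "(\<omega>, y) \<in> (\<Union>m. S m) \<longleftrightarrow> (\<exists>\<sigma>. (y, \<sigma>) \<in> C' \<and> (\<forall>n. \<omega> \<in> A' n \<sigma>))" for \<omega> y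
    proof
      assume "(\<omega>, y) \<in> (\<Union>m. S m)"
      then obtain m \<sigma> where \<sigma>: "(y, \<sigma>) \<in> C m" "\<forall>n. \<omega> \<in> A m n \<sigma>" using S by auto
      have "\<omega> \<in> space M" using sp[OF \<sigma>(2)] .
      with \<sigma> show "\<exists>\<sigma>. (y, \<sigma>) \<in> C' \<and> (\<forall>n. \<omega> \<in> A' n \<sigma>)"
        by (intro exI[of _ "case_nat m \<sigma>"] conjI allI) (simp_all add: C'_def A'_def split: nat.split)
    next
      assume "\<exists>\<sigma>. (y, \<sigma>) \<in> C' \<and> (\<forall>n. \<omega> \<in> A' n \<sigma>)"
      then obtain \<sigma> where \<sigma>: "(y, \<sigma>) \<in> C'" "\<And>n. \<omega> \<in> A' n \<sigma>" by blast
      have "(y, \<lambda>k. \<sigma> (Suc k)) \<in> C (\<sigma> 0)" using \<sigma>(1) by (auto simp: C'_def)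
      moreover have "\<forall>n. \<omega> \<in> A (\<sigma> 0) n (\<lambda>k. \<sigma> (Suc k))"
        using \<sigma>(2)[of "Suc n" for n] by (simp add: A'_def)
      ultimately show "(\<omega>, y) \<in> (\<Union>m. S m)" unfolding S by blast
    qed
  qed
qed

text \<open>One parameter encodes a whole sequence of parameters through the pairing function,
  column \<open>m\<close> being a parameter for \<open>S m\<close>.\<close>

lemma souslin_INT:
  fixes S :: "nat \<Rightarrow> ('a \<times> 'y::euclidean_space) set"
  assumes "\<And>m. souslin M (S m)"
  shows "souslin M (\<Inter>m. S m)"
proof -
  obtain C :: "nat \<Rightarrow> ('y \<times> (nat \<Rightarrow> nat)) set" and A where
    *: "\<forall>m. closed (C m) \<and> (\<forall>n \<sigma>. A m n \<sigma> \<in> sets M) \<and>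
      (\<forall>n \<sigma> \<tau>. (\<forall>i<n. \<sigma> i = \<tau> i) \<longrightarrow> A m n \<sigma> = A m n \<tau>) \<and>
      S m = {(\<omega>, y). \<exists>\<sigma>. (y, \<sigma>) \<in> C m \<and> (\<forall>n. \<omega> \<in> A m n \<sigma>)}"
    using souslin_sequence[of M S, OF assms] by (elim exE)
  have C: "closed (C m)" and A: "A m n \<sigma> \<in> sets M"
    and dep: "(\<And>i. i < n \<Longrightarrow> \<sigma> i = \<tau> i) \<Longrightarrow> A m n \<sigma> = A m n \<tau>"
    and S: "S m = {(\<omega>, y). \<exists>\<sigma>. (y, \<sigma>) \<in> C m \<and> (\<forall>n. \<omega> \<in> A m n \<sigma>)}" for m n \<sigma> \<tau>
    using spec[OF *, of m] by blast+
  define C' where "C' = (\<Inter>m. {z. (fst z, \<lambda>k. snd z (prod_encode (m, k))) \<in> C m})"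
  define A' where "A' = (\<lambda>l \<sigma>. case prod_decode l of (m, n) \<Rightarrow> A m n (\<lambda>k. \<sigma> (prod_encode (m, k))))"
  have A'_encode: "A' (prod_encode (m, n)) \<sigma> = A m n (\<lambda>k. \<sigma> (prod_encode (m, k)))" for m n \<sigma>
    by (simp add: A'_def)
  show ?thesis
  proof (rule souslinI[where C = C' and A = A'])
    show "closed C'"
      unfolding C'_def by (intro closed_INT ballI closed_reindex C)
    show "A' n \<sigma> \<in> sets M" for n \<sigma>
      using A by (simp add: A'_def split: prod.split)
    show "A' l \<sigma> = A' l \<tau>" if eq: "\<And>i. i < l \<Longrightarrow> \<sigma> i = \<tau> i" for l \<sigma> \<tau>
    proof -
      obtain m n where l: "l = prod_encode (m, n)"
        using prod_decode_inverse[of l] by (cases "prod_decode l") auto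
      \<comment> \<open>Monotonicity of the pairing function in its second argument: the first
        \<open>n\<close> entries of column \<open>m\<close> sit at positions below
        \<open>prod_encode (m, n)\<close>, hence stage \<open>l\<close> reads only entries below
        \<open>l\<close>.\<close>
      have "prod_encode (m, k) < prod_encode (m, n)" if "k < n" for k
      proof -
        have "triangle i < triangle j" if "i < j" for i j
          using that by (rule lift_Suc_mono_less[rotated]) simp
        with that show ?thesis by (simp add: prod_encode_def)
      qed
      with eq show ?thesis
        unfolding l A'_encode by (intro dep) simp
    qed
    show "(\<omega>, y) \<in> (\<Inter>m. S m) \<longleftrightarrow> (\<exists>\<sigma>. (y, \<sigma>) \<in> C' \<and> (\<forall>n. \<omega> \<in> A' n \<sigma>))" for \<omega> y
    proof
      assume "(\<omega>, y) \<in> (\<Inter>m. S m)"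
      then have "\<forall>m. \<exists>\<sigma>. (y, \<sigma>) \<in> C m \<and> (\<forall>n. \<omega> \<in> A m n \<sigma>)"
        unfolding S by auto
      from choice[OF this] obtain \<sigma> where
        \<sigma>: "\<And>m. (y, \<sigma> m) \<in> C m" "\<And>m n. \<omega> \<in> A m n (\<sigma> m)" by blast
      define \<tau> where "\<tau> = (\<lambda>l. case prod_decode l of (m, n) \<Rightarrow> \<sigma> m n)"
      have \<tau>: "(\<lambda>k. \<tau> (prod_encode (m, k))) = \<sigma> m" for m
        by (simp add: \<tau>_def)
      show "\<exists>\<sigma>. (y, \<sigma>) \<in> C' \<and> (\<forall>n. \<omega> \<in> A' n \<sigma>)"
        using \<sigma> by (intro exI[of _ \<tau>]) (auto simp: C'_def A'_def \<tau> split: prod.split)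
    next
      assume "\<exists>\<sigma>. (y, \<sigma>) \<in> C' \<and> (\<forall>n. \<omega> \<in> A' n \<sigma>)"
      then obtain \<sigma> where \<sigma>: "(y, \<sigma>) \<in> C'" "\<And>n. \<omega> \<in> A' n \<sigma>" by blast
      have "(y, \<lambda>k. \<sigma> (prod_encode (m, k))) \<in> C m" for m
        using \<sigma>(1) by (auto simp: C'_def)
      moreover have "\<omega> \<in> A m n (\<lambda>k. \<sigma> (prod_encode (m, k)))" for m n
        using \<sigma>(2)[of "prod_encode (m, n)"] by (simp add: A'_encode)
      ultimately show "(\<omega>, y) \<in> (\<Inter>m. S m)" unfolding S by blast
    qed
  qed
qed

lemma souslin_Un:
  assumes "souslin M S" "souslin M T"
  shows "souslin M (S \<union> T)"
proof -
  have "S \<union> T = (\<Union>m::nat. if m = 0 then S else T)"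
    by (auto split: if_splits)
  moreover have "souslin M (\<Union>m::nat. if m = 0 then S else T)"
    using assms by (intro souslin_UN) simp
  ultimately show ?thesis by simp
qed

text \<open>Souslin sets are not closed under complements, so the induction over the Borel sets
  carries a set together with its complement. For closed generators the complement is a countable
  union of compact sets.\<close>

lemma souslin_rectangle:
  fixes B :: "'y::euclidean_space set"
  assumes B: "B \<in> sets borel" and A: "A \<in> sets M"
  shows "souslin M (A \<times> B) \<and> souslin M (A \<times> (UNIV - B))"
proof -
  have "B \<in> sigma_sets UNIV {C. closed C}"
    using B unfolding borel_eq_closed by simp
  then show ?thesis
  proof induction
    case (Basic C)
    have "open (UNIV - C)" using Basic by (simp add: open_Diff)
    then obtain D :: "nat \<Rightarrow> 'y set" where D: "\<And>n. compact (D n)" "(\<Union>n. D n) = UNIV - C"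
      by (rule open_Union_compact_subsets) blast
    have "A \<times> (UNIV - C) = (\<Union>n. A \<times> D n)"
      unfolding D(2)[symmetric] by auto
    moreover have "souslin M (\<Union>n. A \<times> D n)"
      by (intro souslin_UN souslin_closed_rectangle A compact_imp_closed D)
    moreover have "souslin M (A \<times> C)"
      using Basic A by (intro souslin_closed_rectangle) simp_all
    ultimately show ?case by simp
  next
    case Empty
    show ?case using souslin_closed_rectangle[OF A, of "{}"] souslin_closed_rectangle[OF A, of UNIV]
      by simp
  next
    case (Compl a)
    then show ?case by (simp add: Diff_Diff_Int)
  next
    case (Union a)
    have "A \<times> (\<Union>i. a i) = (\<Union>i. A \<times> a i)" "A \<times> (UNIV - (\<Union>i. a i)) = (\<Inter>i. A \<times> (UNIV - a i))"
      by auto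
    moreover have "souslin M (\<Union>i. A \<times> a i)"
      by (rule souslin_UN) (rule conjunct1[OF Union.IH])
    moreover have "souslin M (\<Inter>i. A \<times> (UNIV - a i))"
      by (rule souslin_INT) (rule conjunct2[OF Union.IH])
    ultimately show ?case by (simp only: simp_thms)
  qed
qed

text \<open>Again an induction on a set and its complement; the complement of a measurable rectangle
  is a union of two rectangles.\<close>

lemma souslin_pair_measure:
  fixes S :: "('a \<times> 'y::euclidean_space) set"
  assumes "S \<in> sets (M \<Otimes>\<^sub>M borel)"
  shows "souslin M S"
proof -
  have "S \<in> sigma_sets (space M \<times> UNIV) {a \<times> b |a b. a \<in> sets M \<and> b \<in> sets (borel :: 'y measure)}"
    using assms by (simp add: sets_pair_measure)
  then have "souslin M S \<and> souslin M (space M \<times> UNIV - S)"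
  proof induction
    case (Basic S)
    then obtain A B where S: "S = A \<times> B" and A: "A \<in> sets M" and B: "B \<in> sets borel" by blast
    have "space M \<times> UNIV - S = (space M - A) \<times> UNIV \<union> A \<times> (UNIV - B)"
      using sets.sets_into_space[OF A] by (auto simp: S)
    moreover have "souslin M ((space M - A) \<times> UNIV)"
      using A by (intro souslin_closed_rectangle) auto
    ultimately show ?case
      using souslin_rectangle[OF B A] unfolding S by (auto intro: souslin_Un)
  next
    case Empty
    show ?case
      using souslin_closed_rectangle[of "{}" M UNIV] souslin_closed_rectangle[of "space M" M UNIV]
      by simp
  next
    case (Compl a)
    have "a \<subseteq> space M \<times> UNIV"
      using Compl.hyps by (rule sigma_sets_into_sp[rotated]) (use sets.sets_into_space in fastforce)
    then have "space M \<times> UNIV - (space M \<times> UNIV - a) = a" by blast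
    with Compl show ?case by simp
  next
    case (Union a)
    have "space M \<times> UNIV - (\<Union>i. a i) = (\<Inter>i. space M \<times> UNIV - a i)" by auto
    moreover have "souslin M (\<Union>i. a i)"
      by (rule souslin_UN) (rule conjunct1[OF Union.IH])
    moreover have "souslin M (\<Inter>i. space M \<times> UNIV - a i)"
      by (rule souslin_INT) (rule conjunct2[OF Union.IH])
    ultimately show ?case by (simp only: simp_thms)
  qed
  then show ?thesis by simp
qed

section \<open>Compactness and capacitability\<close>

lemma compact_Pi_atMost: "compact {\<sigma> :: nat \<Rightarrow> nat. \<forall>i. \<sigma> i \<le> h i}"
proof -
  \<comment> \<open>Tychonoff's theorem; every factor is finite.\<close>
  have "compactin (product_topology (\<lambda>i. euclidean) UNIV) (PiE UNIV (\<lambda>i. {..h i}))"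
    by (subst compactin_PiE) (auto simp: compactin_euclidean_iff intro: finite_imp_compact)
  moreover have "PiE UNIV (\<lambda>i. {..h i}) = {\<sigma>. \<forall>i. \<sigma> i \<le> h i}"
    by auto
  ultimately show ?thesis
    by (simp add: euclidean_product_topology compactin_euclidean_iff)
qed

text \<open>Each coordinate is bounded only from some index on, but the finitely many earlier values
  can be absorbed into the bound, which places the sequence in a compact product. Convergence in the
  discrete space \<open>nat\<close> means that each entry is eventually constant.\<close>

lemma bounded_coordinates_convergent_subsequence:
  fixes z :: "nat \<Rightarrow> 'y::euclidean_space \<times> (nat \<Rightarrow> nat)"
  assumes y: "\<And>n. norm (fst (z n)) \<le> b"
    and \<sigma>: "\<And>i. \<exists>N c. \<forall>n\<ge>N. snd (z n) i \<le> c"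
  obtains l r where "strict_mono r" "(z \<circ> r) \<longlonglongrightarrow> l"
    "\<And>i. \<forall>\<^sub>F n in sequentially. snd (z (r n)) i = snd l i"
proof -
  have "\<exists>c. \<forall>n. snd (z n) i \<le> c" for i
  proof -
    obtain N c where "\<forall>n\<ge>N. snd (z n) i \<le> c" using \<sigma> by blast
    then have "snd (z n) i \<le> c + (\<Sum>m<N. snd (z m) i)" for n
      using member_le_sum[of n "{..<N}" "\<lambda>m. snd (z m) i"] by (cases "n < N") (auto intro: add_increasing trans_le_add1)
    then show ?thesis by blast
  qed
  then obtain h where h: "\<And>i n. snd (z n) i \<le> h i" by metis
  have "compact (cball (0::'y) b \<times> {\<sigma> :: nat \<Rightarrow> nat. \<forall>i. \<sigma> i \<le> h i})"
    by (intro compact_Times compact_cball compact_Pi_atMost)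
  then have "seq_compact (cball (0::'y) b \<times> {\<sigma> :: nat \<Rightarrow> nat. \<forall>i. \<sigma> i \<le> h i})"
    by (rule compact_imp_seq_compact)
  moreover have "\<forall>n. z n \<in> cball 0 b \<times> {\<sigma> :: nat \<Rightarrow> nat. \<forall>i. \<sigma> i \<le> h i}"
    using y h by (auto simp: mem_Times_iff)
  ultimately obtain l r where r: "strict_mono r" "(z \<circ> r) \<longlonglongrightarrow> l"
    unfolding seq_compact_def by metis
  have "\<forall>\<^sub>F n in sequentially. snd (z (r n)) i = snd l i" for i
  proof -
    have "(\<lambda>n. snd ((z \<circ> r) n) i) \<longlonglongrightarrow> snd l i"
      by (rule continuous_on_tendsto_compose[OF continuous_on_snd_apply r(2)]) auto
    then show ?thesis by (simp add: tendsto_discrete)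
  qed
  with r that show thesis by blast
qed

text \<open>Choquet's capacitability argument: the coordinates of the Souslin parameter are truncated one
  after the other, each time losing arbitrarily little outer measure. What survives all truncations
  has relatively compact parameters, and is therefore a countable intersection of measurable sets.\<close>
lemma souslin_fst_inner_approx:
  fixes S :: "('a \<times> 'y::euclidean_space) set"
  assumes "finite_measure M" "souslin M S" "c < outer_measure_of M (fst ` S)"
  obtains B where "B \<in> sets M" "B \<subseteq> fst ` S" "c \<le> emeasure M B"
proof -
  interpret finite_measure M by fact
  obtain C :: "('y \<times> (nat \<Rightarrow> nat)) set" and A where C: "closed C" and A: "\<forall>n \<sigma>. A n \<sigma> \<in> sets M"
    and dep: "\<forall>n \<sigma> \<tau>. (\<forall>i<n. \<sigma> i = \<tau> i) \<longrightarrow> A n \<sigma> = A n \<tau>"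
    and S: "S = {(\<omega>, y). \<exists>\<sigma>. (y, \<sigma>) \<in> C \<and> (\<forall>n. \<omega> \<in> A n \<sigma>)}"
    using assms(2) unfolding souslin_def by (elim exE conjE)
  \<comment> \<open>Coordinate 0 is the norm of the point of the Euclidean factor, which also has to
    be truncated to reach compactness; coordinate \<open>Suc j\<close> is entry \<open>j\<close> of
    the parameter.\<close>
  define \<beta> :: "nat \<Rightarrow> 'y \<times> (nat \<Rightarrow> nat) \<Rightarrow> real" where
    "\<beta> i z = (case i of 0 \<Rightarrow> norm (fst z) | Suc j \<Rightarrow> real (snd z j))" for i z
  define G where
    "G h n = {\<omega>. \<exists>z\<in>C. (\<forall>i<n. \<beta> i z \<le> real (h i)) \<and> (\<forall>j. \<omega> \<in> A j (snd z))}" for h :: "nat \<Rightarrow> nat" and n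
  have G0: "G h 0 = fst ` S" for h
    by (force simp: G_def S image_iff)
  have G_space: "G h n \<subseteq> space M" for h n
    using A sets.sets_into_space by (fastforce simp: G_def)
  have G_Suc: "(\<Union>k. G (h(n := k)) (Suc n)) = G h n" for h n
  proof (intro subset_antisym subsetI)
    fix \<omega> assume "\<omega> \<in> G h n"
    then obtain z where z: "z \<in> C" "\<forall>i<n. \<beta> i z \<le> real (h i)" "\<forall>j. \<omega> \<in> A j (snd z)"
      by (auto simp: G_def)
    have "\<forall>i<Suc n. \<beta> i z \<le> real ((h(n := nat \<lceil>\<beta> n z\<rceil>)) i)"
      using z(2) by (auto simp: less_Suc_eq real_nat_ceiling_ge)
    with z(1,3) show "\<omega> \<in> (\<Union>k. G (h(n := k)) (Suc n))"
      unfolding G_def by (intro UN_I[OF UNIV_I] CollectI bexI[of _ z] conjI)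
  qed (auto simp: G_def less_Suc_eq)
  \<comment> \<open>Relaxing the bound on coordinate \<open>n\<close> exhausts \<open>G h n\<close>,
    and outer measure is continuous along increasing sequences of arbitrary sets. Hence some finite
    bound keeps the outer measure above \<open>c\<close>.\<close>
  have step: "\<exists>h'. c < outer_measure_of M (G h' (Suc n)) \<and> (\<forall>i<n. h' i = h i)"
    if "c < outer_measure_of M (G h n)" for h n
  proof -
    have "incseq (\<lambda>k. G (h(n := k)) (Suc n))"
    proof (rule incseq_SucI, rule subsetI)
      fix k \<omega> assume "\<omega> \<in> G (h(n := k)) (Suc n)"
      then obtain z where z: "z \<in> C" "\<forall>i<Suc n. \<beta> i z \<le> real ((h(n := k)) i)" "\<forall>j. \<omega> \<in> A j (snd z)"
        by (auto simp: G_def)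
      have mono: "real ((h(n := k)) i) \<le> real ((h(n := Suc k)) i)" for i by simp
      have "\<forall>i<Suc n. \<beta> i z \<le> real ((h(n := Suc k)) i)"
        by (intro allI impI order_trans[OF z(2)[rule_format] mono])
      with z(1,3) show "\<omega> \<in> G (h(n := Suc k)) (Suc n)"
        unfolding G_def by (intro CollectI bexI[of _ z] conjI)
    qed
    then have "(SUP k. outer_measure_of M (G (h(n := k)) (Suc n))) = outer_measure_of M (G h n)"
      using SUP_outer_measure_of_incseq[of "\<lambda>k. G (h(n := k)) (Suc n)" M, OF G_space]
      by (simp only: G_Suc)
    with that have "c < (SUP k. outer_measure_of M (G (h(n := k)) (Suc n)))" by (simp only:)
    then obtain k where "c < outer_measure_of M (G (h(n := k)) (Suc n))"
      unfolding less_SUP_iff by (elim bexE)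
    then show ?thesis by (intro exI[of _ "h(n := k)"]) auto
  qed
  have "\<exists>H. \<forall>n. c < outer_measure_of M (G (H n) n) \<and> (\<forall>i<n. H (Suc n) i = H n i)"
    using assms(3) step by (intro dependent_nat_choice) (auto simp: G0)
  then obtain H where H: "\<And>n. c < outer_measure_of M (G (H n) n)" "\<And>n i. i < n \<Longrightarrow> H (Suc n) i = H n i"
    by blast
  \<comment> \<open>The bound on coordinate \<open>i\<close> is chosen in passing from stage
    \<open>i\<close> to stage \<open>Suc i\<close> and never changes afterwards.\<close>
  define h where "h i = H (Suc i) i" for i
  have "H n i = h i" if "i < n" for n i
    using that
  proof (induction n)
    case (Suc n)
    then show ?case by (cases "i = n") (auto simp: h_def H(2))
  qed simp
  then have "G h n = G (H n) n" for n
    by (auto simp: G_def)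
  with H(1) have h: "c < outer_measure_of M (G h n)" for n by metis
  \<comment> \<open>Unlike \<open>G h n\<close>, the larger \<open>Q n\<close> constrains only finitely many coordinates, hence is measurable.\<close>
  define Q where
    "Q n = {\<omega>. \<exists>z\<in>C. (\<forall>i<n. \<beta> i z \<le> real (h i)) \<and> (\<forall>j\<le>n. \<omega> \<in> A j (snd z))}" for n
  have Q_sets: "Q n \<in> sets M" for n
  proof -
    let ?f = "\<lambda>\<sigma>. \<Inter>j\<le>n. A j \<sigma>"
    let ?Z = "snd ` {z\<in>C. \<forall>i<n. \<beta> i z \<le> real (h i)}"
    \<comment> \<open>Stages up to \<open>n\<close> read only the entries below \<open>n\<close>.
      The parameters can therefore be replaced by finite lists, of which there are countably many;
      entries beyond the list are never read.\<close>
    define D where "D xs = ?f ((!) xs)" for xs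
    have D: "?f \<sigma> = D (map \<sigma> [0..<n])" for \<sigma>
      unfolding D_def
    proof (intro INF_cong refl)
      fix j assume "j \<in> {..n}"
      then show "A j \<sigma> = A j ((!) (map \<sigma> [0..<n]))"
        by (intro dep[rule_format]) simp
    qed
    have "?f ` ?Z \<subseteq> range D"
      unfolding D by (intro image_subsetI rangeI)
    then have "countable (?f ` ?Z)"
      by (rule countable_subset) simp
    moreover have "?f ` ?Z \<subseteq> sets M"
      by (intro image_subsetI sets.finite_INT A[rule_format]) auto
    ultimately have "\<Union>(?f ` ?Z) \<in> sets M" by (rule sets.countable_Union)
    moreover have "\<Union>(?f ` ?Z) = Q n" by (auto simp: Q_def)
    ultimately show ?thesis by simp
  qed
  have "decseq Q"
  proof (rule decseq_SucI, rule subsetI)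
    fix n \<omega> assume "\<omega> \<in> Q (Suc n)"
    then obtain z where "z \<in> C" "\<forall>i<Suc n. \<beta> i z \<le> real (h i)" "\<forall>j\<le>Suc n. \<omega> \<in> A j (snd z)"
      unfolding Q_def by (elim CollectE bexE conjE)
    then show "\<omega> \<in> Q n"
      unfolding Q_def by (intro CollectI bexI[of _ z] conjI) simp_all
  qed
  then have lim: "(\<lambda>n. emeasure M (Q n)) \<longlonglongrightarrow> emeasure M (\<Inter>n. Q n)"
    using Q_sets by (intro Lim_emeasure_decseq) auto
  have "c \<le> emeasure M (Q n)" for n
  proof -
    have "G h n \<subseteq> Q n"
      unfolding G_def Q_def by (intro Collect_mono impI) (elim bexE conjE, intro bexI conjI, simp_all)
    then have "outer_measure_of M (G h n) \<le> emeasure M (Q n)"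
      using outer_measure_of_mono[of "G h n" "Q n" M] Q_sets by simp
    with h[of n] show ?thesis by simp
  qed
  then have "c \<le> emeasure M (\<Inter>n. Q n)"
    by (intro LIMSEQ_le_const[OF lim]) auto
  \<comment> \<open>Parameters witnessing membership in the sets \<open>Q n\<close> have a
    convergent subsequence. Its limit lies in the closed set \<open>C\<close> and agrees with late
    members of the subsequence on any finite number of entries, so it satisfies all stages at
    once.\<close>
  moreover have "(\<Inter>n. Q n) \<subseteq> fst ` S"
  proof
    fix \<omega> assume "\<omega> \<in> (\<Inter>n. Q n)"
    \<comment> \<open>Membership is used at \<open>Suc n\<close>, so that coordinate 0, the norm, is
      bounded for every \<open>n\<close> including 0.\<close>
    then have "\<forall>n. \<exists>z\<in>C. (\<forall>i<Suc n. \<beta> i z \<le> real (h i)) \<and> (\<forall>j\<le>Suc n. \<omega> \<in> A j (snd z))"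
      unfolding Q_def by simp
    then have "\<forall>n. \<exists>z. z \<in> C \<and> (\<forall>i<Suc n. \<beta> i z \<le> real (h i)) \<and> (\<forall>j\<le>Suc n. \<omega> \<in> A j (snd z))"
      unfolding Bex_def .
    from choice[OF this] obtain z where
      *: "\<forall>n. z n \<in> C \<and> (\<forall>i<Suc n. \<beta> i (z n) \<le> real (h i)) \<and> (\<forall>j\<le>Suc n. \<omega> \<in> A j (snd (z n)))" ..
    have z: "z n \<in> C" "i < Suc n \<Longrightarrow> \<beta> i (z n) \<le> real (h i)"
        "j \<le> Suc n \<Longrightarrow> \<omega> \<in> A j (snd (z n))" for n i j
      using spec[OF *, of n] by simp_all
    have "norm (fst (z n)) \<le> real (h 0)" for n
      using z(2)[of 0 n] by (simp add: \<beta>_def)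
    moreover have "\<exists>N c. \<forall>n\<ge>N. snd (z n) i \<le> c" for i
      using z(2)[of "Suc i"] by (intro exI[of _ "Suc i"] exI[of _ "h (Suc i)"]) (simp add: \<beta>_def)
    ultimately obtain l r where r: "strict_mono r" "(z \<circ> r) \<longlonglongrightarrow> l"
      and l: "\<And>i. \<forall>\<^sub>F n in sequentially. snd (z (r n)) i = snd l i"
      by (rule bounded_coordinates_convergent_subsequence) blast
    have "l \<in> C"
      by (rule Lim_in_closed_set[OF C _ _ r(2)]) (simp_all add: z(1))
    moreover have "\<omega> \<in> A j (snd l)" for j
    proof -
      have "\<forall>\<^sub>F n in sequentially. \<forall>i<j. snd (z (r n)) i = snd l i"
        using l eventually_ball_finite_distrib[of "{..<j}" "\<lambda>n i. snd (z (r n)) i = snd l i" sequentially]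
        by (simp add: Ball_def)
      then have "\<forall>\<^sub>F n in sequentially. j \<le> n \<and> (\<forall>i<j. snd (z (r n)) i = snd l i)"
        by (intro eventually_conj eventually_ge_at_top)
      then obtain n where n: "j \<le> n" "\<forall>i<j. snd (z (r n)) i = snd l i"
        by (auto dest: eventually_happens)
      have "j \<le> Suc (r n)" using n(1) seq_suble[OF r(1), of n] by simp
      then have "\<omega> \<in> A j (snd (z (r n)))" by (rule z(3))
      also have "A j (snd (z (r n))) = A j (snd l)" using dep n(2) by blast
      finally show ?thesis .
    qed
    ultimately show "\<omega> \<in> fst ` S"
      unfolding S by (intro image_eqI[of _ _ "(\<omega>, fst l)"]) (auto intro: exI[of _ "snd l"])
  qed
  ultimately show thesis
    using that[of "\<Inter>n. Q n"] Q_sets by (auto intro: sets.countable_INT)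
qed

text \<open>A measurable hull \<open>E\<close> from outside and a countable union \<open>U\<close>
  of inner approximations have the same finite measure, so the projection differs from
  \<open>U\<close> by a subset of the null set \<open>E - U\<close>.\<close>

lemma measurable_projection:
  fixes S :: "('a \<times> 'y::euclidean_space) set"
  assumes M: "finite_measure M" and S: "S \<in> sets (M \<Otimes>\<^sub>M borel)"
  shows "fst ` S \<in> sets (completion M)"
proof -
  interpret finite_measure M by fact
  have sub: "fst ` S \<subseteq> space M"
    using sets.sets_into_space[OF S] by (auto simp: space_pair_measure)
  obtain E where E: "E \<in> sets M" "fst ` S \<subseteq> E" "outer_measure_of M (fst ` S) = emeasure M E"
    using outer_measure_of_attain[OF sub] by (elim bexE conjE)
  have "\<exists>B. B \<in> sets M \<and> B \<subseteq> fst ` S \<and> emeasure M E \<le> emeasure M B + ennreal (1 / real (Suc n))" for n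
  \<comment> \<open>The inner approximation needs a value strictly below the outer measure. If that
    is 0 there is none, and the empty set serves instead.\<close>
  proof (cases "emeasure M E = 0")
    case False
    then have "emeasure M E - ennreal (1 / real (Suc n)) < outer_measure_of M (fst ` S)"
      unfolding E(3) by (intro ennreal_between) (simp_all add: zero_less_iff_neq_zero less_top[symmetric])
    then obtain B where "B \<in> sets M" "B \<subseteq> fst ` S" "emeasure M E - ennreal (1 / real (Suc n)) \<le> emeasure M B"
      by (rule souslin_fst_inner_approx[OF M souslin_pair_measure[OF S]])
    then show ?thesis by (intro exI[of _ B]) (simp add: ennreal_minus_le_iff add.commute)
  qed (simp add: exI[of _ "{}"])
  then have "\<forall>n. \<exists>B. B \<in> sets M \<and> B \<subseteq> fst ` S \<and> emeasure M E \<le> emeasure M B + ennreal (1 / real (Suc n))"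
    by (rule allI)
  from choice[OF this] obtain B where B: "\<And>n. B n \<in> sets M" "\<And>n. B n \<subseteq> fst ` S"
    "\<And>n. emeasure M E \<le> emeasure M (B n) + ennreal (1 / real (Suc n))" by auto
  define U where "U = (\<Union>n. B n)"
  have U: "U \<in> sets M" "U \<subseteq> fst ` S" using B by (auto simp: U_def)
  have "emeasure M E \<le> emeasure M U"
  proof (rule ennreal_le_epsilon)
    fix e :: real assume "0 < e"
    then obtain n where n: "1 / real (Suc n) < e" by (rule nat_approx_posE)
    have "emeasure M E \<le> emeasure M (B n) + ennreal (1 / real (Suc n))" by (rule B(3))
    also have "\<dots> \<le> emeasure M U + ennreal e"
      using n U by (intro add_mono emeasure_mono ennreal_leI) (auto simp: U_def)
    finally show "emeasure M E \<le> emeasure M U + ennreal e" .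
  qed
  then have "emeasure M (E - U) = 0"
    using U E by (subst emeasure_Diff) (auto simp: diff_eq_0_iff_ennreal less_top[symmetric])
  then have "E - U \<in> null_sets M" using U(1) E(1) by auto
  then show ?thesis
    using U E(2) by (intro sets_completionI[of "fst ` S" U "fst ` S - U" "E - U"]) auto
qed

subsection \<open>Recurrence\<close>

text \<open>Points of \<open>E\<close> that never return after time \<open>N\<close> form a set with
  infinitely many disjoint preimages of equal probability, which must be null.\<close>

lemma poincare_recurrence_flow:
  fixes \<theta> :: "'d::euclidean_space \<Rightarrow> 'w \<Rightarrow> 'w"
  assumes P: "prob_space P" and flow: "measurable_flow P \<theta>" and inv: "flow_invariant P \<theta>"
    and E: "E \<in> sets P"
  shows "AE \<omega> in P. \<omega> \<in> E \<longrightarrow> (\<forall>N. \<exists>n\<ge>N. \<theta> (real n *\<^sub>R v) \<omega> \<in> E)"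
proof -
  interpret prob_space P by fact
  have meas [measurable]: "\<theta> s \<in> measurable P P" for s
  proof -
    have "(\<lambda>\<omega>. (\<omega>, s)) \<in> measurable P (P \<Otimes>\<^sub>M borel)" by measurable
    moreover have "(\<lambda>(\<omega>, s). \<theta> s \<omega>) \<in> measurable (P \<Otimes>\<^sub>M borel) P"
      using flow unfolding measurable_flow_def by (rule conjunct1)
    ultimately have "(\<lambda>\<omega>. (\<lambda>(\<omega>, s). \<theta> s \<omega>) (\<omega>, s)) \<in> measurable P P"
      by (rule measurable_compose)
    then show ?thesis by simp
  qed
  have add: "\<theta> s (\<theta> t \<omega>) = \<theta> (s + t) \<omega>" if "\<omega> \<in> space P" for s t \<omega>
    using flow that unfolding measurable_flow_def by blast
  define A where "A N = {\<omega>\<in>E. \<forall>n\<ge>Suc N. \<theta> (real n *\<^sub>R v) \<omega> \<notin> E}" for N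
  have A: "A N \<in> sets P" for N
  proof -
    have "A N = {\<omega>\<in>space P. \<omega> \<in> E \<and> (\<forall>n\<in>{Suc N..}. \<theta> (real n *\<^sub>R v) \<omega> \<notin> E)}"
      using sets.sets_into_space[OF E] by (auto simp: A_def)
    also have "\<dots> \<in> sets P" using E by measurable
    finally show ?thesis .
  qed
  have null: "A N \<in> null_sets P" for N
  proof -
    \<comment> \<open>Times are spaced by \<open>Suc N\<close>: a point in two of these preimages
      would make a point of \<open>A N\<close> return to \<open>E\<close> after at least
      \<open>Suc N\<close> steps.\<close>
    define B where "B j = \<theta> (real (j * Suc N) *\<^sub>R v) -` A N \<inter> space P" for j
    have B: "B j \<in> sets P" for j
      unfolding B_def using A by measurable
    have "emeasure P (B j) = emeasure P (A N)" for j
    proof -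
      have "emeasure P (B j) = emeasure (distr P P (\<theta> (real (j * Suc N) *\<^sub>R v))) (A N)"
        unfolding B_def using A by (subst emeasure_distr) auto
      with inv show ?thesis by (simp add: flow_invariant_def)
    qed
    then have prob: "prob (B j) = prob (A N)" for j
      by (simp add: measure_def)
    have disj_lt: "B i \<inter> B j = {}" if "i < j" for i j
    proof -
      have False if "\<omega> \<in> B i" "\<omega> \<in> B j" for \<omega>
      proof -
        obtain e where j: "j = i + Suc e" using \<open>i < j\<close> less_iff_Suc_add by auto
        define d where "d = Suc e * Suc N"
        have d: "d \<ge> Suc N" "real (j * Suc N) = real d + real (i * Suc N)"
          by (simp_all add: d_def j algebra_simps)
        have "\<theta> (real (j * Suc N) *\<^sub>R v) \<omega> = \<theta> (real d *\<^sub>R v) (\<theta> (real (i * Suc N) *\<^sub>R v) \<omega>)"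
          using that unfolding d(2) by (subst add) (auto simp: B_def scaleR_add_left)
        moreover have "\<theta> (real (j * Suc N) *\<^sub>R v) \<omega> \<in> E" "\<theta> (real (i * Suc N) *\<^sub>R v) \<omega> \<in> A N"
          using that by (auto simp: B_def A_def)
        ultimately show False using d(1) by (auto simp: A_def)
      qed
      then show ?thesis by blast
    qed
    have "disjoint_family B"
      unfolding disjoint_family_on_def using disj_lt by (metis Int_commute nat_neq_iff)
    \<comment> \<open>Any number of disjoint sets of equal probability must fit into total mass
      1.\<close>
    have "real n * prob (A N) \<le> 1" for n
    proof -
      have "real n * prob (A N) = (\<Sum>j<n. prob (B j))" by (simp add: prob)
      also have "\<dots> = prob (\<Union>j<n. B j)"
        using B \<open>disjoint_family B\<close>
        by (intro finite_measure_finite_Union[symmetric]) (auto simp: disjoint_family_on_def)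
      finally show ?thesis by simp
    qed
    then have "\<not> 0 < prob (A N)"
      using reals_Archimedean3[of "prob (A N)"] not_le by blast
    then have "prob (A N) = 0"
      using measure_nonneg[of P "A N"] by linarith
    then have "emeasure P (A N) = 0" by (simp add: emeasure_eq_measure)
    with A show ?thesis by (rule null_setsI[rotated])
  qed
  have "AE \<omega> in P. \<forall>N. \<omega> \<notin> A N"
    unfolding AE_all_countable using AE_not_in[OF null] by blast
  then show ?thesis
  proof eventually_elim
    case (elim \<omega>)
    show ?case
    proof (intro impI allI)
      fix N assume "\<omega> \<in> E"
      with elim have "\<not> (\<forall>n\<ge>Suc N. \<theta> (real n *\<^sub>R v) \<omega> \<notin> E)"
        unfolding A_def by simp
      then show "\<exists>n\<ge>N. \<theta> (real n *\<^sub>R v) \<omega> \<in> E"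
        using Suc_leD by blast
    qed
  qed
qed

subsection \<open>Geometry\<close>

text \<open>The coordinate of largest absolute value carries at least the fraction
  \<open>1 / DIM('d)\<close> of the sum of all of them, which dominates the norm. Thus finitely many
  cones cover the space.\<close>

lemma exists_signed_Basis_inner:
  fixes \<xi> :: "'d::euclidean_space"
  obtains v where "v \<in> Basis \<union> uminus ` Basis" "norm \<xi> \<le> real DIM('d) * (\<xi> \<bullet> v)"
proof -
  have "Max ((\<lambda>b. \<bar>\<xi> \<bullet> b\<bar>) ` Basis) \<in> (\<lambda>b. \<bar>\<xi> \<bullet> b\<bar>) ` Basis"
    by (intro Max_in) auto
  then obtain b where b: "b \<in> Basis" "Max ((\<lambda>b. \<bar>\<xi> \<bullet> b\<bar>) ` Basis) = \<bar>\<xi> \<bullet> b\<bar>"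
    by (elim imageE)
  have le: "\<bar>\<xi> \<bullet> b'\<bar> \<le> \<bar>\<xi> \<bullet> b\<bar>" if "b' \<in> Basis" for b'
    unfolding b(2)[symmetric] using that by (intro Max_ge) auto
  have "norm \<xi> \<le> (\<Sum>b'\<in>Basis. \<bar>\<xi> \<bullet> b'\<bar>)" by (rule norm_le_l1)
  also have "\<dots> \<le> real DIM('d) * \<bar>\<xi> \<bullet> b\<bar>"
    using le by (rule sum_bounded_above)
  finally show thesis
    using that[of b] that[of "- b"] b(1) by (cases "\<xi> \<bullet> b \<ge> 0") auto
qed

text \<open>Expanding the squared distances leaves the comparison of
  \<open>\<xi> \<bullet> w\<close> with \<open>\<xi> \<bullet> x\<close>. The advance
  \<open>n\<close> contributes at least \<open>norm \<xi> * (k + R + 1)\<close>; the deviation of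
  \<open>w\<close> costs at most \<open>norm \<xi> * k\<close> and \<open>x\<close> at most
  \<open>norm \<xi> * R\<close>. The surplus \<open>norm \<xi>\<close> outweighs
  \<open>(norm w)\<^sup>2\<close>.\<close>

lemma far_point_closer_to_advanced_ball:
  fixes \<xi> w x v :: "'d::euclidean_space"
  assumes v: "norm \<xi> \<le> real DIM('d) * (\<xi> \<bullet> v)"
    and n: "real DIM('d) * (k + R + 1) \<le> n"
    and w: "dist (n *\<^sub>R v) w \<le> k" and x: "norm x \<le> R" and far: "(norm w)\<^sup>2 < norm \<xi>"
  shows "dist \<xi> w < dist \<xi> x"
proof -
  have "0 \<le> k" "0 \<le> R" using w x by (meson dist_not_less_zero norm_ge_zero order_trans zero_le_dist)+
  have "0 \<le> n" using \<open>0 \<le> k\<close> \<open>0 \<le> R\<close> n by (smt (verit) of_nat_0_le_iff mult_nonneg_nonneg)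
  have "real DIM('d) * (norm \<xi> * (k + R + 1)) \<le> norm \<xi> * n"
    using mult_left_mono[OF n norm_ge_zero[of \<xi>]] by (simp add: mult_ac)
  also have "\<dots> \<le> real DIM('d) * (n * (\<xi> \<bullet> v))"
    using mult_right_mono[OF v \<open>0 \<le> n\<close>] by (simp add: mult_ac)
  finally have adv: "norm \<xi> * (k + R + 1) \<le> n * (\<xi> \<bullet> v)"
    using DIM_positive[where 'a='d] by simp
  have "\<bar>\<xi> \<bullet> (w - n *\<^sub>R v)\<bar> \<le> norm \<xi> * k"
    using w by (intro order_trans[OF Cauchy_Schwarz_ineq2] mult_left_mono) (auto simp: dist_norm norm_minus_commute)
  moreover have "\<bar>\<xi> \<bullet> x\<bar> \<le> norm \<xi> * R"
    using x by (intro order_trans[OF Cauchy_Schwarz_ineq2] mult_left_mono) auto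
  ultimately have "norm \<xi> \<le> \<xi> \<bullet> w - \<xi> \<bullet> x"
    using adv by (simp add: inner_diff_right algebra_simps)
  moreover have "(dist \<xi> w)\<^sup>2 = (norm \<xi>)\<^sup>2 + (norm w)\<^sup>2 - 2 * (\<xi> \<bullet> w)"
    by (simp add: dist_norm power2_norm_eq_inner inner_diff_left inner_diff_right inner_commute)
  moreover have "(dist \<xi> x)\<^sup>2 = (norm \<xi>)\<^sup>2 + (norm x)\<^sup>2 - 2 * (\<xi> \<bullet> x)"
    by (simp add: dist_norm power2_norm_eq_inner inner_diff_left inner_diff_right inner_commute)
  ultimately have "(dist \<xi> w)\<^sup>2 < (dist \<xi> x)\<^sup>2"
    using far norm_ge_zero[of \<xi>] zero_le_power2[of "norm x"] by linarith
  then show ?thesis by (rule power2_less_imp_less) simp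
qed

subsection \<open>Stable densities between fixed measures\<close>

text \<open>Otherwise \<open>w\<close> desires \<open>\<xi>\<close> because of its farther partner
  \<open>\<eta>\<close>, and \<open>\<xi>\<close> desires \<open>w\<close> because it is served by
  the farther site \<open>x\<close>.\<close>

lemma stable_blocked:
  assumes "stable \<phi> \<psi> f"
    and "f w \<eta> > 0" "dist w \<xi> < dist w \<eta>" "f x \<xi> > 0" "dist w \<xi> < dist x \<xi>"
  shows "1 \<le> f w \<xi>"
  using assms unfolding stable_def site_desires_def center_desires_def by (meson not_le)

lemma exists_far_partner:
  assumes "\<not> bounded (\<Union>x\<in>X. site_territory f x)"
  obtains w \<eta> where "w \<in> X" "f w \<eta> > 0" "b < norm \<eta>"
proof -
  have "\<exists>\<eta>\<in>(\<Union>x\<in>X. site_territory f x). b < norm \<eta>"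
    using assms unfolding bounded_iff by (meson not_le)
  then show thesis using that by (auto simp: site_territory_def)
qed

text \<open>The countable form in which unboundedness becomes an intersection of projections of
  measurable sets.\<close>

lemma not_bounded_UN_site_territory_iff:
  "\<not> bounded (\<Union>x\<in>X. site_territory f x) \<longleftrightarrow> (\<forall>m::nat. \<exists>x\<in>X. \<exists>\<xi>. real m < norm \<xi> \<and> f x \<xi> > 0)"
proof
  assume "\<not> bounded (\<Union>x\<in>X. site_territory f x)"
  then show "\<forall>m::nat. \<exists>x\<in>X. \<exists>\<xi>. real m < norm \<xi> \<and> f x \<xi> > 0"
    by (metis exists_far_partner)
next
  assume *: "\<forall>m::nat. \<exists>x\<in>X. \<exists>\<xi>. real m < norm \<xi> \<and> f x \<xi> > 0"
  show "\<not> bounded (\<Union>x\<in>X. site_territory f x)"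
  proof
    assume "bounded (\<Union>x\<in>X. site_territory f x)"
    then obtain b where b: "\<forall>\<xi>\<in>(\<Union>x\<in>X. site_territory f x). norm \<xi> \<le> b"
      unfolding bounded_iff by (elim exE)
    obtain m :: nat where "b \<le> real m" using real_arch_simple by blast
    obtain x \<xi> where "x \<in> X" "real m < norm \<xi>" "f x \<xi> > 0" using * by blast
    with b have "norm \<xi> \<le> b" by (auto simp: site_territory_def)
    with \<open>b \<le> real m\<close> \<open>real m < norm \<xi>\<close> show False by simp
  qed
qed

lemma constrained_density_measurable:
  assumes "constrained_density \<phi> \<psi> f"
  shows "(\<lambda>\<xi>. f x \<xi>) \<in> borel_measurable borel" "(\<lambda>x. f x \<xi>) \<in> borel_measurable borel"
proof -
  have "(\<lambda>(x, y). f x y) \<in> borel_measurable (borel \<Otimes>\<^sub>M borel)"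
    using assms by (simp add: constrained_density_def)
  from measurable_Pair2[OF this, of x] measurable_Pair1[OF this, of \<xi>]
  show "(\<lambda>\<xi>. f x \<xi>) \<in> borel_measurable borel" "(\<lambda>x. f x \<xi>) \<in> borel_measurable borel"
    by simp_all
qed

text \<open>Markov's inequality at level 1. It bounds both the centers that one site serves fully
  and the sites that serve one center fully.\<close>

lemma full_assignment_mass_le_1:
  assumes meas: "sets \<mu> = sets borel" and "(\<integral>\<^sup>+x. ennreal (g x) \<partial>\<mu>) \<le> 1"
    and "B \<in> sets borel" "\<And>x. x \<in> B \<Longrightarrow> 1 \<le> g x"
  shows "emeasure \<mu> B \<le> 1"
proof -
  have "emeasure \<mu> B = (\<integral>\<^sup>+x. indicator B x \<partial>\<mu>)"
    using assms by simp
  also have "\<dots> \<le> (\<integral>\<^sup>+x. ennreal (g x) \<partial>\<mu>)"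
    using assms(4) by (intro nn_integral_mono) (auto simp: indicator_def)
  finally show ?thesis using assms(2) by simp
qed

text \<open>Outside a large ball, a center serving \<open>K\<close> lies in the cone of some
  \<open>v\<close> and is nearer to the sites of a ball advanced along \<open>v\<close> than to its
  own site in \<open>K\<close>. By stability, those sites of the ball that have a partner far enough
  away serve it fully.\<close>

lemma finite_outer_UN_site_territory:
  fixes f :: "'d::euclidean_space \<Rightarrow> 'd \<Rightarrow> real"
  assumes f: "constrained_density \<phi> \<psi> f" "stable \<phi> \<psi> f" and \<psi>: "locally_finite_borel \<psi>"
    and rec: "\<And>v N. v \<in> Basis \<union> uminus ` Basis \<Longrightarrow>
      \<exists>n\<ge>N. \<not> bounded (\<Union>x\<in>cball (real n *\<^sub>R v) (real k). site_territory f x)"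
    and K: "bounded K"
  shows "finite_outer \<psi> (\<Union>x\<in>K. site_territory f x)"
proof -
  have sets: "sets \<psi> = sets borel" using \<psi> by (simp add: locally_finite_borel_def)
  obtain R where R: "\<And>x. x \<in> K \<Longrightarrow> norm x \<le> R"
    using K unfolding bounded_iff by blast
  define SB :: "'d set" where "SB = Basis \<union> uminus ` Basis"
  define N where "N = nat \<lceil>real DIM('d) * (real k + R + 1)\<rceil>"
  have "\<forall>v\<in>SB. \<exists>n\<ge>N. \<not> bounded (\<Union>x\<in>cball (real n *\<^sub>R v) (real k). site_territory f x)"
    using rec unfolding SB_def by blast
  then obtain n where n: "\<And>v. v \<in> SB \<Longrightarrow> N \<le> n v"
    "\<And>v. v \<in> SB \<Longrightarrow> \<not> bounded (\<Union>x\<in>cball (real (n v) *\<^sub>R v) (real k). site_territory f x)"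
    by metis
  \<comment> \<open>All sites \<open>w v j\<close> for a given \<open>v\<close> come from one ball,
    so their norms stay bounded while the partners \<open>\<eta> v j\<close> escape to
    infinity.\<close>
  have far: "\<exists>w \<eta>. w \<in> cball (real (n v) *\<^sub>R v) (real k) \<and> f w \<eta> > 0 \<and> real j < norm \<eta>" if "v \<in> SB" for v j
    using exists_far_partner[OF n(2)[OF that], of "real j"] by metis
  then have "\<forall>v\<in>SB. \<forall>j. \<exists>w \<eta>. w \<in> cball (real (n v) *\<^sub>R v) (real k) \<and> f w \<eta> > 0 \<and> real j < norm \<eta>"
    by blast
  then obtain w \<eta> where w: "\<And>v j. v \<in> SB \<Longrightarrow> w v j \<in> cball (real (n v) *\<^sub>R v) (real k)"
    and \<eta>: "\<And>v j. v \<in> SB \<Longrightarrow> f (w v j) (\<eta> v j) > 0" "\<And>v j. v \<in> SB \<Longrightarrow> real j < norm (\<eta> v j)"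
    by metis
  \<comment> \<open>\<open>A v\<close> is the limit inferior of the sets of centers served fully by
    \<open>w v j\<close>. Each \<open>B v J\<close> has mass at most 1, and so has their increasing
    union.\<close>
  define B where "B v J = {\<xi>. \<forall>j\<ge>J. 1 \<le> f (w v j) \<xi>}" for v J
  define A where "A v = (\<Union>J. B v J)" for v
  have B: "B v J \<in> sets borel" for v J
  proof -
    have "B v J = (\<Inter>j\<in>{J..}. {\<xi>\<in>space borel. 1 \<le> f (w v j) \<xi>})" by (auto simp: B_def)
    also have "\<dots> \<in> sets borel"
      by (intro sets.countable_INT'' sets.countable_INT' borel_measurable_le)
        (auto intro!: borel_measurable_le constrained_density_measurable[OF f(1)])
    finally show ?thesis .
  qed
  have A: "A v \<in> sets borel" "emeasure \<psi> (A v) \<le> 1" for v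
  proof -
    show "A v \<in> sets borel" using B by (auto simp: A_def)
    have "incseq (B v)" by (rule incseq_SucI) (auto simp: B_def)
    moreover have "range (B v) \<subseteq> sets \<psi>" unfolding sets using B by (rule image_subsetI)
    ultimately have "emeasure \<psi> (A v) = (SUP J. emeasure \<psi> (B v J))"
      using SUP_emeasure_incseq[of "B v" \<psi>] by (simp add: A_def)
    also have "\<dots> \<le> 1"
    proof (rule SUP_least)
      fix J
      show "emeasure \<psi> (B v J) \<le> 1"
        by (rule full_assignment_mass_le_1[OF sets _ B, where g = "f (w v J)"])
          (use f(1) in \<open>auto simp: B_def constrained_density_def\<close>)
    qed
    finally show "emeasure \<psi> (A v) \<le> 1" .
  qed
  have finite_SB: "finite SB" by (simp add: SB_def)
  \<comment> \<open>A sum over the directions in place of a maximum; each term bounds the squared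
    norms of the sites \<open>w v j\<close>.\<close>
  define \<rho> where "\<rho> = (\<Sum>v\<in>SB. (real (n v) + real k)\<^sup>2)"
  have "(\<Union>x\<in>K. site_territory f x) \<subseteq> cball 0 \<rho> \<union> (\<Union>v\<in>SB. A v)"
  proof
    fix \<xi> assume "\<xi> \<in> (\<Union>x\<in>K. site_territory f x)"
    then obtain x where x: "x \<in> K" "f x \<xi> > 0" by (auto simp: site_territory_def)
    show "\<xi> \<in> cball 0 \<rho> \<union> (\<Union>v\<in>SB. A v)"
    proof (cases "norm \<xi> \<le> \<rho>")
      case False
      obtain v where v: "v \<in> SB" "norm \<xi> \<le> real DIM('d) * (\<xi> \<bullet> v)"
        unfolding SB_def by (rule exists_signed_Basis_inner)
      have "norm v = 1" using v(1) by (auto simp: SB_def)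
      have norm_w: "norm (w v j) \<le> real (n v) + real k" for j
        using w[OF v(1), of j] norm_triangle_ineq4[of "real (n v) *\<^sub>R v" "real (n v) *\<^sub>R v - w v j"] \<open>norm v = 1\<close>
        by (simp add: dist_norm)
      have "(real (n v) + real k)\<^sup>2 \<le> \<rho>"
        unfolding \<rho>_def using v(1) finite_SB by (intro member_le_sum) auto
      with False have far: "(real (n v) + real k)\<^sup>2 < norm \<xi>" by simp
      \<comment> \<open>From \<open>J\<close> on the partner of \<open>w v j\<close> has norm above
        \<open>2 * norm (w v j) + norm \<xi>\<close>, hence is farther from \<open>w v j\<close>
        than \<open>\<xi>\<close> is.\<close>
      define J where "J = nat \<lceil>2 * (real (n v) + real k) + norm \<xi>\<rceil>"
      have "1 \<le> f (w v j) \<xi>" if "j \<ge> J" for j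
      proof (rule stable_blocked[OF f(2) \<eta>(1)[OF v(1)] _ x(2)])
        have "2 * (real (n v) + real k) + norm \<xi> \<le> real j"
          using that unfolding J_def by linarith
        also have "\<dots> < norm (\<eta> v j)" by (rule \<eta>(2)[OF v(1)])
        finally have "norm (w v j) + norm \<xi> < norm (\<eta> v j) - norm (w v j)"
          using norm_w[of j] by simp
        moreover have "dist (w v j) \<xi> \<le> norm (w v j) + norm \<xi>"
          by (simp add: dist_norm norm_triangle_ineq4)
        moreover have "norm (\<eta> v j) - norm (w v j) \<le> dist (w v j) (\<eta> v j)"
          by (metis dist_commute dist_norm norm_triangle_ineq2)
        ultimately show "dist (w v j) \<xi> < dist (w v j) (\<eta> v j)" by linarith
        have "dist \<xi> (w v j) < dist \<xi> x"
        proof (rule far_point_closer_to_advanced_ball[OF v(2)])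
          show "real DIM('d) * (real k + R + 1) \<le> real (n v)"
            using n(1)[OF v(1)] unfolding N_def by linarith
          show "dist (real (n v) *\<^sub>R v) (w v j) \<le> real k" using w[OF v(1)] by simp
          show "norm x \<le> R" by (rule R[OF x(1)])
          have "(norm (w v j))\<^sup>2 \<le> (real (n v) + real k)\<^sup>2" by (intro power_mono norm_w) simp
          then show "(norm (w v j))\<^sup>2 < norm \<xi>" using far by (rule le_less_trans)
        qed
        then show "dist (w v j) \<xi> < dist x \<xi>" by (simp add: dist_commute)
      qed
      then have "\<xi> \<in> A v" by (auto simp: A_def B_def)
      with v(1) show ?thesis by blast
    qed simp
  qed
  moreover have "cball 0 \<rho> \<union> (\<Union>v\<in>SB. A v) \<in> sets \<psi>"
    using A finite_SB by (auto simp: sets intro!: sets.finite_UN)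
  moreover have "emeasure \<psi> (cball 0 \<rho> \<union> (\<Union>v\<in>SB. A v)) < \<infinity>"
  proof -
    have "emeasure \<psi> (\<Union>v\<in>SB. A v) \<le> (\<Sum>v\<in>SB. emeasure \<psi> (A v))"
      using A finite_SB by (intro emeasure_subadditive_finite) (auto simp: sets)
    also have "\<dots> \<le> (\<Sum>v\<in>SB. 1)" by (intro sum_mono A)
    also have "\<dots> < \<infinity>" by (simp add: of_nat_less_top)
    finally have "emeasure \<psi> (\<Union>v\<in>SB. A v) < \<infinity>" .
    moreover have "emeasure \<psi> (cball 0 \<rho>) < \<infinity>"
      using \<psi> by (simp add: locally_finite_borel_def)
    ultimately have "emeasure \<psi> (cball 0 \<rho>) + emeasure \<psi> (\<Union>v\<in>SB. A v) < \<infinity>"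
      by simp
    moreover have "emeasure \<psi> (cball 0 \<rho> \<union> (\<Union>v\<in>SB. A v)) \<le> emeasure \<psi> (cball 0 \<rho>) + emeasure \<psi> (\<Union>v\<in>SB. A v)"
      using A finite_SB by (intro emeasure_subadditive) (auto simp: sets intro!: sets.finite_UN)
    ultimately show ?thesis by (rule le_less_trans[rotated])
  qed
  ultimately show ?thesis unfolding finite_outer_def by blast
qed

text \<open>If the total mass were finite, continuity from above along the tails, whose intersection is
  empty, would contradict the lower bound.\<close>
lemma escaping_sets_infinite_mass:
  fixes V :: "nat \<Rightarrow> 'd::euclidean_space set"
  assumes sets: "sets \<phi> = sets borel" and V: "\<And>i. V i \<in> sets borel" "\<And>i. c \<le> emeasure \<phi> (V i)"
    and c: "0 < c" and esc: "\<And>i x. x \<in> V i \<Longrightarrow> real i \<le> norm x + b"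
  shows "\<exists>r::nat. 1 < emeasure \<phi> ((\<Union>i. V i) \<inter> cball 0 (real r))"
proof -
  define A where "A m = (\<Union>i\<in>{m..}. V i)" for m
  have A: "A m \<in> sets \<phi>" for m using V(1) by (auto simp: A_def sets)
  have "decseq A" unfolding A_def by (intro decseq_SucI UN_mono) auto
  have "emeasure \<phi> (A 0) = \<infinity>"
  proof (rule ccontr)
    assume fin: "emeasure \<phi> (A 0) \<noteq> \<infinity>"
    have "emeasure \<phi> (A m) \<noteq> \<infinity>" for m
    proof -
      have "A m \<subseteq> A 0" by (auto simp: A_def)
      then have "emeasure \<phi> (A m) \<le> emeasure \<phi> (A 0)" using A by (intro emeasure_mono)
      with fin show ?thesis by (auto simp: top_unique)
    qed
    then have "(\<lambda>m. emeasure \<phi> (A m)) \<longlonglongrightarrow> emeasure \<phi> (\<Inter>m. A m)"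
      using A \<open>decseq A\<close> by (intro Lim_emeasure_decseq) auto
    moreover have "(\<Inter>m. A m) = {}"
    proof -
      have False if "\<forall>m. x \<in> A m" for x
      proof -
        obtain m :: nat where "norm x + b < real m" using reals_Archimedean2 by blast
        moreover from that have "x \<in> A m" ..
        then obtain i where "i \<ge> m" "x \<in> V i" by (auto simp: A_def)
        ultimately show False using esc[of x i] by linarith
      qed
      then show ?thesis by blast
    qed
    ultimately have "(\<lambda>m. emeasure \<phi> (A m)) \<longlonglongrightarrow> 0" by simp
    moreover have "c \<le> emeasure \<phi> (A m)" for m
      using V(2)[of m] A[of m] by (intro order_trans[OF V(2)[of m]] emeasure_mono) (auto simp: A_def)
    ultimately have "c \<le> 0" by (intro LIMSEQ_le_const) auto
    with c show False by simp
  qed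
  \<comment> \<open>Exhaustion by balls: since the total mass is infinite, some ball already
    contains mass above 1.\<close>
  moreover have "emeasure \<phi> (A 0) = (SUP r. emeasure \<phi> (A 0 \<inter> cball 0 (real r)))"
  proof -
    have "incseq (\<lambda>r. A 0 \<inter> cball 0 (real r))" by (rule incseq_SucI) auto
    moreover have "A 0 = (\<Union>r. A 0 \<inter> cball 0 (real r))"
      using real_arch_simple by fastforce
    ultimately show ?thesis
      using A[of 0] by (subst SUP_emeasure_incseq) (auto simp: sets)
  qed
  ultimately have *: "(SUP r. emeasure \<phi> (A 0 \<inter> cball 0 (real r))) = \<infinity>" by metis
  have "1 < (SUP r. emeasure \<phi> (A 0 \<inter> cball 0 (real r)))" unfolding * by simp
  then show ?thesis unfolding less_SUP_iff by (auto simp: A_def)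
qed

text \<open>If \<open>x0\<close> had an unbounded territory, a far center in it would be nearer to
  every site of some bounded set \<open>W v\<close> of unbounded sites than to \<open>x0\<close>.
  Stability then makes all of \<open>W v\<close>, of mass above 1, serve this center fully.\<close>

lemma bounded_site_territory:
  fixes f :: "'d::euclidean_space \<Rightarrow> 'd \<Rightarrow> real"
  assumes f: "constrained_density \<phi> \<psi> f" "stable \<phi> \<psi> f" and \<phi>: "sets \<phi> = sets borel" and c: "0 < c"
    and rec: "\<And>v N. v \<in> Basis \<union> uminus ` Basis \<Longrightarrow> \<exists>n\<ge>N. \<exists>V\<in>sets borel.
      V \<subseteq> cball (real n *\<^sub>R v) (real k) \<and> V \<subseteq> {x. \<not> bounded (site_territory f x)} \<and> c \<le> emeasure \<phi> V"
  shows "bounded (site_territory f x0)"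
proof (rule ccontr)
  assume unb: "\<not> bounded (site_territory f x0)"
  define SB :: "'d set" where "SB = Basis \<union> uminus ` Basis"
  define U where "U = {x. \<not> bounded (site_territory f x)}"
  define N where "N = nat \<lceil>real DIM('d) * (real k + norm x0 + 1)\<rceil>"
  have "\<exists>W r. W \<in> sets borel \<and> W \<subseteq> U \<and> W \<subseteq> cball 0 (real r) \<and> 1 < emeasure \<phi> W \<and>
      (\<forall>w\<in>W. \<exists>n\<ge>N. dist (real n *\<^sub>R v) w \<le> real k)" if v: "v \<in> SB" for v
  proof -
    \<comment> \<open>The bound \<open>N\<close> is for the geometry, the bound \<open>i\<close>
      makes the sets escape to infinity.\<close>
    have "\<forall>i. \<exists>n V. max N i \<le> n \<and> V \<in> sets borel \<and> V \<subseteq> cball (real n *\<^sub>R v) (real k) \<and>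
        V \<subseteq> U \<and> c \<le> emeasure \<phi> V"
      using rec[OF v[unfolded SB_def], folded U_def] unfolding Bex_def by (intro allI) iprover
    then obtain n V where V: "\<And>i. max N i \<le> n i" "\<And>i. V i \<in> sets borel"
      "\<And>i. V i \<subseteq> cball (real (n i) *\<^sub>R v) (real k)" "\<And>i. V i \<subseteq> U" "\<And>i. c \<le> emeasure \<phi> (V i)"
      by metis
    have "norm v = 1" using v by (auto simp: SB_def)
    have "real i \<le> norm x + real k" if "x \<in> V i" for i x
    proof -
      have "real (n i) = norm (real (n i) *\<^sub>R v)" using \<open>norm v = 1\<close> by simp
      also have "\<dots> \<le> norm x + dist (real (n i) *\<^sub>R v) x"
        by (metis add.commute diff_add_cancel dist_norm norm_triangle_ineq)
      finally show ?thesis using V(1)[of i] V(3)[of i] that by (auto simp: subset_iff)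
    qed
    then obtain r :: nat where r: "1 < emeasure \<phi> ((\<Union>i. V i) \<inter> cball 0 (real r))"
      using escaping_sets_infinite_mass[of \<phi> V c "real k"] \<phi> V(2,5) c by blast
    have "\<exists>n\<ge>N. dist (real n *\<^sub>R v) w \<le> real k" if "w \<in> (\<Union>i. V i) \<inter> cball 0 (real r)" for w
      using that V(1,3) by (fastforce simp: subset_iff)
    with r V(2,4) show ?thesis
      by (intro exI[of _ "(\<Union>i. V i) \<inter> cball 0 (real r)"] exI[of _ r]) auto
  qed
  then obtain W r where W: "\<And>v. v \<in> SB \<Longrightarrow> W v \<in> sets borel" "\<And>v. v \<in> SB \<Longrightarrow> W v \<subseteq> U"
    "\<And>v. v \<in> SB \<Longrightarrow> W v \<subseteq> cball 0 (real (r v))" "\<And>v. v \<in> SB \<Longrightarrow> 1 < emeasure \<phi> (W v)"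
    "\<And>v w. v \<in> SB \<Longrightarrow> w \<in> W v \<Longrightarrow> \<exists>n\<ge>N. dist (real n *\<^sub>R v) w \<le> real k"
    by metis
  have "finite SB" by (simp add: SB_def)
  have partner: "\<exists>\<eta>. f w \<eta> > 0 \<and> b < norm \<eta>" if "w \<in> U" for w b
    using that exists_far_partner[where X = "{w}" and f = f and b = b] by (auto simp: U_def)
  \<comment> \<open>The center is taken beyond a bound valid for every direction, since the cone
    containing it is known only afterwards.\<close>
  obtain \<xi> where \<xi>: "f x0 \<xi> > 0" "(\<Sum>v\<in>SB. (real (r v))\<^sup>2) < norm \<xi>"
    using partner[of x0] unb by (auto simp: U_def)
  obtain v where v: "v \<in> SB" "norm \<xi> \<le> real DIM('d) * (\<xi> \<bullet> v)"
    unfolding SB_def by (rule exists_signed_Basis_inner)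
  have "(real (r v))\<^sup>2 \<le> (\<Sum>v\<in>SB. (real (r v))\<^sup>2)"
    using v(1) \<open>finite SB\<close> by (intro member_le_sum) auto
  with \<xi>(2) have far: "(real (r v))\<^sup>2 < norm \<xi>" by simp
  have one: "1 \<le> f w \<xi>" if "w \<in> W v" for w
  proof -
    obtain n where n: "n \<ge> N" "dist (real n *\<^sub>R v) w \<le> real k"
      using W(5)[OF v(1) \<open>w \<in> W v\<close>] by blast
    have "norm w \<le> real (r v)" using W(3)[OF v(1)] that by auto
    then have "(norm w)\<^sup>2 \<le> (real (r v))\<^sup>2" by (intro power_mono) simp_all
    then have "(norm w)\<^sup>2 < norm \<xi>" using far by (rule le_less_trans)
    moreover have "real DIM('d) * (real k + norm x0 + 1) \<le> real n"
      using n(1) unfolding N_def by linarith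
    ultimately have "dist \<xi> w < dist \<xi> x0"
      by (intro far_point_closer_to_advanced_ball[OF v(2) _ n(2) order_refl])
    moreover obtain \<eta> where "f w \<eta> > 0" "2 * norm w + norm \<xi> < norm \<eta>"
      using partner[of w "2 * norm w + norm \<xi>"] W(2)[OF v(1)] \<open>w \<in> W v\<close> by blast
    moreover have "dist w \<xi> \<le> norm w + norm \<xi>"
      by (simp add: dist_norm norm_triangle_ineq4)
    moreover have "norm \<eta> - norm w \<le> dist w \<eta>"
      by (metis dist_commute dist_norm norm_triangle_ineq2)
    ultimately show ?thesis
      using \<xi>(1) by (intro stable_blocked[OF f(2), of w \<eta> \<xi> x0]) (auto simp: dist_commute)
  qed
  have "emeasure \<phi> (W v) \<le> 1"
    by (rule full_assignment_mass_le_1[OF \<phi> _ W(1)[OF v(1)] one])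
      (use f(1) in \<open>auto simp: constrained_density_def\<close>)
  with W(4)[OF v(1)] show False by simp
qed

lemma inverse_one_plus_le_1: "inverse (1 + a) \<le> (1 :: ennreal)"
proof (cases a)
  case (real r)
  then have "1 + a = ennreal (1 + r)" by simp
  with real show ?thesis by (simp add: inverse_ennreal inverse_le_1_iff del: ennreal_plus)
qed simp

subsection \<open>Flow-adapted stable densities\<close>

text \<open>The setting for the statements about sites; a second interpretation with exchanged roles
  yields those about centers.\<close>

locale stable_transport = prob_space P
  for P :: "'w measure" +
  fixes \<theta> :: "'d::euclidean_space \<Rightarrow> 'w \<Rightarrow> 'w"
    and \<Phi> \<Psi> :: "'w \<Rightarrow> 'd measure"
    and F :: "'w \<Rightarrow> 'd \<Rightarrow> 'd \<Rightarrow> real"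
  assumes flow: "measurable_flow P \<theta>"
    and \<Phi>: "stationary_random_measure P \<theta> \<Phi>"
    and \<Psi>: "stationary_random_measure P \<theta> \<Psi>"
    and F_measurable: "(\<lambda>(\<omega>, x, y). F \<omega> x y) \<in> borel_measurable (P \<Otimes>\<^sub>M (borel \<Otimes>\<^sub>M borel))"
    and F_shift: "\<And>s \<omega> x y. \<omega> \<in> space P \<Longrightarrow> F (\<theta> s \<omega>) x y = F \<omega> (x + s) (y + s)"
    and F_constrained: "\<And>\<omega>. \<omega> \<in> space P \<Longrightarrow> constrained_density (\<Phi> \<omega>) (\<Psi> \<omega>) (F \<omega>)"
    and F_stable: "\<And>\<omega>. \<omega> \<in> space P \<Longrightarrow> stable (\<Phi> \<omega>) (\<Psi> \<omega>) (F \<omega>)"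
begin

lemma flow_in_space: "\<omega> \<in> space P \<Longrightarrow> \<theta> s \<omega> \<in> space P"
  using flow unfolding measurable_flow_def
  by (auto dest!: measurable_space[where x = "(\<omega>, s)"] simp: space_pair_measure)

lemma \<Phi>_locally_finite: "\<omega> \<in> space P \<Longrightarrow> locally_finite_borel (\<Phi> \<omega>)"
  using \<Phi> unfolding stationary_random_measure_def random_measure_def by blast

lemma \<Psi>_locally_finite: "\<omega> \<in> space P \<Longrightarrow> locally_finite_borel (\<Psi> \<omega>)"
  using \<Psi> unfolding stationary_random_measure_def random_measure_def by blast

lemma sets_\<Phi> [simp]: "\<omega> \<in> space P \<Longrightarrow> sets (\<Phi> \<omega>) = sets borel"
  using \<Phi>_locally_finite by (simp add: locally_finite_borel_def)

lemma sets_\<Psi> [simp]: "\<omega> \<in> space P \<Longrightarrow> sets (\<Psi> \<omega>) = sets borel"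
  using \<Psi>_locally_finite by (simp add: locally_finite_borel_def)

lemma \<Phi>_measurable: "B \<in> sets borel \<Longrightarrow> (\<lambda>\<omega>. emeasure (\<Phi> \<omega>) B) \<in> borel_measurable P"
  using \<Phi> unfolding stationary_random_measure_def random_measure_def by blast

lemma \<Phi>_shift:
  "\<omega> \<in> space P \<Longrightarrow> B \<in> sets borel \<Longrightarrow> emeasure (\<Phi> (\<theta> s \<omega>)) B = emeasure (\<Phi> \<omega>) ((\<lambda>x. x + s) ` B)"
  using \<Phi> unfolding stationary_random_measure_def by blast

lemma flow_inv: "flow_invariant P \<theta>"
  using \<Phi> unfolding stationary_random_measure_def by blast

lemma site_territory_shift:
  assumes "\<omega> \<in> space P"
  shows "site_territory (F (\<theta> s \<omega>)) x = (\<lambda>\<xi>. \<xi> - s) ` site_territory (F \<omega>) (x + s)"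
proof (intro subset_antisym subsetI)
  fix \<xi> assume "\<xi> \<in> site_territory (F (\<theta> s \<omega>)) x"
  then show "\<xi> \<in> (\<lambda>\<xi>. \<xi> - s) ` site_territory (F \<omega>) (x + s)"
    using assms by (intro image_eqI[of _ _ "\<xi> + s"]) (simp_all add: site_territory_def F_shift)
qed (use assms in \<open>auto simp: site_territory_def F_shift\<close>)

lemma recurrence:
  assumes "E \<in> sets P"
  shows "AE \<omega> in P. \<omega> \<in> E \<longrightarrow> (\<forall>v\<in>(Basis :: 'd set) \<union> uminus ` Basis. \<forall>N. \<exists>n\<ge>N. \<theta> (real n *\<^sub>R v) \<omega> \<in> E)"
proof -
  have "AE \<omega> in P. \<forall>v\<in>(Basis :: 'd set) \<union> uminus ` Basis. \<omega> \<in> E \<longrightarrow> (\<forall>N. \<exists>n\<ge>N. \<theta> (real n *\<^sub>R v) \<omega> \<in> E)"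
    by (intro AE_finite_allI poincare_recurrence_flow prob_space_axioms flow flow_inv assms) simp
  then show ?thesis by eventually_elim blast
qed

text \<open>Almost every point of \<open>E\<close> lies in a measurable subset \<open>S\<close> that
  differs from \<open>E\<close> by part of a null set, and returning to \<open>S\<close> is
  returning to \<open>E\<close>.\<close>

lemma recurrence_completion:
  assumes "E \<in> sets (completion P)"
  shows "AE \<omega> in P. \<omega> \<in> E \<longrightarrow> (\<forall>v\<in>(Basis :: 'd set) \<union> uminus ` Basis. \<forall>N. \<exists>n\<ge>N. \<theta> (real n *\<^sub>R v) \<omega> \<in> E)"
proof -
  obtain S N N' where E: "E = S \<union> N" "N \<subseteq> N'" "N' \<in> null_sets P" "S \<in> sets P"
    using assms by (rule sets_completionE)
  from AE_not_in[OF E(3)] recurrence[OF E(4)] show ?thesis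
  proof eventually_elim
    case (elim \<omega>)
    show ?case
    proof (intro impI ballI allI)
      fix v :: 'd and N0 assume "\<omega> \<in> E" and v: "v \<in> Basis \<union> uminus ` Basis"
      with elim(1) E(1,2) have "\<omega> \<in> S" by blast
      with elim(2) v obtain n where "n \<ge> N0" "\<theta> (real n *\<^sub>R v) \<omega> \<in> S" by blast
      then show "\<exists>n\<ge>N0. \<theta> (real n *\<^sub>R v) \<omega> \<in> E" using E(1) by blast
    qed
  qed
qed

section \<open>Finite mass of the territories of bounded sets\<close>

definition unbounded_territory_event :: "nat \<Rightarrow> 'w set" where
  "unbounded_territory_event k = {\<omega>\<in>space P. \<not> bounded (\<Union>x\<in>cball 0 (real k). site_territory (F \<omega>) x)}"

lemma unbounded_territory_event_sets: "unbounded_territory_event k \<in> sets (completion P)"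
proof -
  define S where "S m = {p\<in>space (P \<Otimes>\<^sub>M (borel \<Otimes>\<^sub>M borel)).
    norm (fst (snd p)) \<le> real k \<and> real m < norm (snd (snd p)) \<and>
    0 < (case p of (\<omega>, x, y) \<Rightarrow> F \<omega> x y)}" for m :: nat
  \<comment> \<open>Site and center are merged into one point of a product Euclidean space, so that
    a single projection removes both.\<close>
  have "S m \<in> sets (P \<Otimes>\<^sub>M (borel :: ('d \<times> 'd) measure))" for m
    unfolding S_def borel_prod[symmetric] using F_measurable by measurable
  then have "fst ` S m \<in> sets (completion P)" for m
    by (intro measurable_projection[OF finite_measure_axioms])
  then have "(\<Inter>m. fst ` S m) \<in> sets (completion P)"
    by (intro sets.countable_INT') auto
  also have "(\<Inter>m. fst ` S m) = unbounded_territory_event k"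
  proof -
    have "fst ` S m = {\<omega>\<in>space P. \<exists>x\<in>cball 0 (real k). \<exists>\<xi>. real m < norm \<xi> \<and> F \<omega> x \<xi> > 0}" for m
      by (force simp: S_def space_pair_measure image_iff)
    then show ?thesis
      unfolding unbounded_territory_event_def not_bounded_UN_site_territory_iff by auto
  qed
  finally show ?thesis .
qed

lemma unbounded_territory_event_shift:
  assumes "\<omega> \<in> space P" "\<theta> s \<omega> \<in> unbounded_territory_event k"
  shows "\<not> bounded (\<Union>x\<in>cball s (real k). site_territory (F \<omega>) x)"
proof
  assume "bounded (\<Union>x\<in>cball s (real k). site_territory (F \<omega>) x)"
  then have "bounded ((\<lambda>\<xi>. \<xi> - s) ` (\<Union>x\<in>cball s (real k). site_territory (F \<omega>) x))"
    by (rule bounded_translation_minus)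
  moreover have "(\<Union>x\<in>cball 0 (real k). site_territory (F (\<theta> s \<omega>)) x) \<subseteq>
      (\<lambda>\<xi>. \<xi> - s) ` (\<Union>x\<in>cball s (real k). site_territory (F \<omega>) x)"
  proof (rule UN_least)
    fix x :: 'd assume "x \<in> cball 0 (real k)"
    then have "x + s \<in> cball s (real k)" by (simp add: dist_norm)
    then show "site_territory (F (\<theta> s \<omega>)) x \<subseteq> (\<lambda>\<xi>. \<xi> - s) ` (\<Union>x\<in>cball s (real k). site_territory (F \<omega>) x)"
      unfolding site_territory_shift[OF assms(1)] by blast
  qed
  ultimately have "bounded (\<Union>x\<in>cball 0 (real k). site_territory (F (\<theta> s \<omega>)) x)"
    by (rule bounded_subset)
  with assms(2) show False by (simp add: unbounded_territory_event_def)
qed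

lemma AE_finite_outer_UN_site_territory:
  "AE \<omega> in P. \<forall>K. bounded K \<longrightarrow> finite_outer (\<Psi> \<omega>) (\<Union>x\<in>K. site_territory (F \<omega>) x)"
proof -
  have "AE \<omega> in P. \<forall>k. \<omega> \<in> unbounded_territory_event k \<longrightarrow>
      (\<forall>v\<in>(Basis :: 'd set) \<union> uminus ` Basis. \<forall>N. \<exists>n\<ge>N. \<theta> (real n *\<^sub>R v) \<omega> \<in> unbounded_territory_event k)"
    unfolding AE_all_countable
    by (intro allI recurrence_completion unbounded_territory_event_sets)
  with AE_space show ?thesis
  proof eventually_elim
    case (elim \<omega>)
    show ?case
    proof (intro allI impI)
      fix K :: "'d set" assume K: "bounded K"
      show "finite_outer (\<Psi> \<omega>) (\<Union>x\<in>K. site_territory (F \<omega>) x)"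
      \<comment> \<open>Either some ball has an unbounded territory and recurrence supplies such
        balls in all directions, or the territory of \<open>K\<close> is itself bounded and local
        finiteness suffices.\<close>
      proof (cases "\<exists>k. \<omega> \<in> unbounded_territory_event k")
        case True
        then obtain k where k: "\<omega> \<in> unbounded_territory_event k" ..
        show ?thesis
        proof (rule finite_outer_UN_site_territory[OF F_constrained F_stable \<Psi>_locally_finite _ K])
          fix v :: 'd and N assume "v \<in> Basis \<union> uminus ` Basis"
          with elim(2) k obtain n where n: "n \<ge> N" "\<theta> (real n *\<^sub>R v) \<omega> \<in> unbounded_territory_event k"
            by blast
          then show "\<exists>n\<ge>N. \<not> bounded (\<Union>x\<in>cball (real n *\<^sub>R v) (real k). site_territory (F \<omega>) x)"
            using unbounded_territory_event_shift[OF elim(1)] by blast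
        qed (rule elim(1))+
      next
        case False
        obtain b where b: "\<And>x. x \<in> K \<Longrightarrow> norm x \<le> b" using K unfolding bounded_iff by blast
        obtain k :: nat where "b \<le> real k" using real_arch_simple by blast
        with b have "K \<subseteq> cball 0 (real k)" by fastforce
        moreover have "bounded (\<Union>x\<in>cball 0 (real k). site_territory (F \<omega>) x)"
          using False elim(1) by (simp add: unbounded_territory_event_def)
        ultimately have "bounded (\<Union>x\<in>K. site_territory (F \<omega>) x)"
          by (meson UN_mono bounded_subset order_refl)
        then obtain r where "\<forall>\<xi>\<in>(\<Union>x\<in>K. site_territory (F \<omega>) x). norm \<xi> \<le> r"
          unfolding bounded_iff by (elim exE)
        then have "(\<Union>x\<in>K. site_territory (F \<omega>) x) \<subseteq> cball 0 r" by auto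
        moreover have "emeasure (\<Psi> \<omega>) (cball 0 r) < \<infinity>"
          using \<Psi>_locally_finite[OF elim(1)] by (simp add: locally_finite_borel_def)
        ultimately show ?thesis
          unfolding finite_outer_def using elim(1) by (intro bexI[of _ "cball 0 r"]) auto
      qed
    qed
  qed
qed

section \<open>Bounded territories of almost all sites\<close>

text \<open>The normalisation makes this a subprobability kernel without affecting its null sets in the ball.\<close>
definition local_kernel :: "nat \<Rightarrow> 'w \<Rightarrow> 'd measure" where
  "local_kernel k \<omega> = density (\<Phi> \<omega>)
    (\<lambda>x. indicator (cball 0 (real k)) x * inverse (1 + emeasure (\<Phi> \<omega>) (cball 0 (real k))))"

lemma sets_local_kernel [simp]: "\<omega> \<in> space P \<Longrightarrow> sets (local_kernel k \<omega>) = sets borel"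
  by (simp add: local_kernel_def)

lemma emeasure_local_kernel:
  assumes "\<omega> \<in> space P" "A \<in> sets borel"
  shows "emeasure (local_kernel k \<omega>) A =
    emeasure (\<Phi> \<omega>) (A \<inter> cball 0 (real k)) * inverse (1 + emeasure (\<Phi> \<omega>) (cball 0 (real k)))"
proof -
  let ?c = "inverse (1 + emeasure (\<Phi> \<omega>) (cball 0 (real k)))"
  have [measurable]: "A \<in> sets (\<Phi> \<omega>)" "cball 0 (real k) \<in> sets (\<Phi> \<omega>)" using assms by simp_all
  have "emeasure (local_kernel k \<omega>) A = (\<integral>\<^sup>+x. indicator (cball 0 (real k)) x * ?c * indicator A x \<partial>\<Phi> \<omega>)"
    unfolding local_kernel_def by (intro emeasure_density) measurable
  also have "\<dots> = (\<integral>\<^sup>+x. indicator (A \<inter> cball 0 (real k)) x * ?c \<partial>\<Phi> \<omega>)"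
    by (intro nn_integral_cong) (simp split: split_indicator)
  also have "\<dots> = emeasure (\<Phi> \<omega>) (A \<inter> cball 0 (real k)) * ?c"
    by (subst nn_integral_multc) simp_all
  finally show ?thesis .
qed

lemma emeasure_local_kernel_le:
  assumes "\<omega> \<in> space P" "A \<in> sets borel"
  shows "emeasure (local_kernel k \<omega>) A \<le> emeasure (\<Phi> \<omega>) (A \<inter> cball 0 (real k))"
  unfolding emeasure_local_kernel[OF assms]
  using mult_left_mono[OF inverse_one_plus_le_1, of "emeasure (\<Phi> \<omega>) (A \<inter> cball 0 (real k))"] by simp

lemma local_kernel_measurable [measurable]: "local_kernel k \<in> measurable P (subprob_algebra borel)"
proof (rule measurable_subprob_algebra)
  fix \<omega> assume \<omega>: "\<omega> \<in> space P"
  show "subprob_space (local_kernel k \<omega>)"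
  proof
    let ?a = "emeasure (\<Phi> \<omega>) (cball 0 (real k))"
    have sp: "space (local_kernel k \<omega>) = UNIV"
      using sets_eq_imp_space_eq[OF sets_local_kernel[OF \<omega>]] by simp
    have "?a < top"
      using \<Phi>_locally_finite[OF \<omega>] by (simp add: locally_finite_borel_def)
    then have "(1 + ?a) * inverse (1 + ?a) = 1"
      by (simp flip: divide_ennreal_def)
    moreover have "?a * inverse (1 + ?a) \<le> (1 + ?a) * inverse (1 + ?a)"
      by (intro mult_right_mono) simp_all
    ultimately show "emeasure (local_kernel k \<omega>) (space (local_kernel k \<omega>)) \<le> 1"
      unfolding sp by (simp add: emeasure_local_kernel \<omega>)
    show "space (local_kernel k \<omega>) \<noteq> {}" by (simp add: sp)
  qed
  show "sets (local_kernel k \<omega>) = sets borel" using \<omega> by simp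
next
  fix A :: "'d set" assume A: "A \<in> sets borel"
  have [measurable]: "(\<lambda>\<omega>. emeasure (\<Phi> \<omega>) (A \<inter> cball 0 (real k))) \<in> borel_measurable P"
      "(\<lambda>\<omega>. emeasure (\<Phi> \<omega>) (cball 0 (real k))) \<in> borel_measurable P"
    using A by (auto intro!: \<Phi>_measurable)
  have "(\<lambda>\<omega>. emeasure (\<Phi> \<omega>) (A \<inter> cball 0 (real k)) * inverse (1 + emeasure (\<Phi> \<omega>) (cball 0 (real k))))
      \<in> borel_measurable P" by measurable
  then show "(\<lambda>\<omega>. emeasure (local_kernel k \<omega>) A) \<in> borel_measurable P"
    by (subst measurable_cong[OF emeasure_local_kernel[OF _ A]])
qed

text \<open>The density is positive on the ball, since the finite mass of the ball keeps the
  normalising factor away from 0.\<close>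

lemma AE_local_kernel_iff:
  assumes "\<omega> \<in> space P"
  shows "(AE x in local_kernel k \<omega>. Q x) \<longleftrightarrow> (AE x in \<Phi> \<omega>. x \<in> cball 0 (real k) \<longrightarrow> Q x)"
proof -
  let ?c = "inverse (1 + emeasure (\<Phi> \<omega>) (cball 0 (real k)))"
  have "emeasure (\<Phi> \<omega>) (cball 0 (real k)) < top"
    using \<Phi>_locally_finite[OF assms] by (simp add: locally_finite_borel_def)
  then have c: "0 < ?c" by (auto simp: zero_less_iff_neq_zero ennreal_inverse_eq_0_iff)
  have [measurable]: "cball 0 (real k) \<in> sets (\<Phi> \<omega>)" using assms by simp
  have "(AE x in local_kernel k \<omega>. Q x) \<longleftrightarrow>
      (AE x in \<Phi> \<omega>. 0 < indicator (cball 0 (real k)) x * ?c \<longrightarrow> Q x)"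
    unfolding local_kernel_def by (intro AE_density) measurable
  also have "\<dots> \<longleftrightarrow> (AE x in \<Phi> \<omega>. x \<in> cball 0 (real k) \<longrightarrow> Q x)"
    using c by (intro AE_cong) (simp split: split_indicator)
  finally show ?thesis .
qed

definition unbounded_sites :: "('w \<times> 'd) set" where
  "unbounded_sites = {p\<in>space P \<times> UNIV. \<not> bounded (site_territory (F (fst p)) (snd p))}"

text \<open>A normalised Campbell measure of \<open>\<Phi>\<close> on the ball of radius
  \<open>k\<close>. Its completion measures the set of unbounded sites, and its null sets have null
  slices for almost every \<open>\<omega>\<close>.\<close>

definition campbell :: "nat \<Rightarrow> ('w \<times> 'd) measure" where
  "campbell k = P \<bind> (\<lambda>\<omega>. distr (local_kernel k \<omega>) (P \<Otimes>\<^sub>M borel) (Pair \<omega>))"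

lemma campbell_kernel_measurable [measurable]:
  "(\<lambda>\<omega>. distr (local_kernel k \<omega>) (P \<Otimes>\<^sub>M borel) (Pair \<omega>)) \<in> measurable P (subprob_algebra (P \<Otimes>\<^sub>M borel))"
  by (rule measurable_distr2[of _ _ borel]) measurable

lemma sets_campbell [simp]: "sets (campbell k) = sets (P \<Otimes>\<^sub>M borel)"
  unfolding campbell_def
  by (rule sets_bind[OF sets_kernel[OF campbell_kernel_measurable] not_empty])

lemma finite_measure_campbell: "finite_measure (campbell k)"
proof -
  have "subprob_space (campbell k)"
    unfolding campbell_def
    by (rule subprob_space_bind[OF _ campbell_kernel_measurable]) (rule prob_space_imp_subprob_space[OF prob_space_axioms])
  then show ?thesis by (rule subprob_space.axioms)
qed

lemma unbounded_sites_sets: "unbounded_sites \<in> sets (completion (campbell k))"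
proof -
  define S where "S m = {p\<in>space ((P \<Otimes>\<^sub>M borel) \<Otimes>\<^sub>M borel).
    real m < norm (snd p) \<and> 0 < (case (fst (fst p), snd (fst p), snd p) of (\<omega>, x, y) \<Rightarrow> F \<omega> x y)}" for m :: nat
  have "S m \<in> sets ((P \<Otimes>\<^sub>M borel) \<Otimes>\<^sub>M borel)" for m
  proof -
    have [measurable]: "(\<lambda>p. case (fst (fst p), snd (fst p), snd p) of (\<omega>, x, y) \<Rightarrow> F \<omega> x y)
        \<in> borel_measurable ((P \<Otimes>\<^sub>M borel) \<Otimes>\<^sub>M borel)"
      by (rule measurable_compose[OF _ F_measurable]) measurable
    show ?thesis unfolding S_def by measurable
  qed
  moreover have "sets (campbell k \<Otimes>\<^sub>M (borel :: 'd measure)) = sets ((P \<Otimes>\<^sub>M borel) \<Otimes>\<^sub>M borel)"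
    by (intro sets_pair_measure_cong sets_campbell refl)
  ultimately have "fst ` S m \<in> sets (completion (campbell k))" for m
    by (intro measurable_projection finite_measure_campbell) simp
  then have "(\<Inter>m. fst ` S m) \<in> sets (completion (campbell k))"
    by (intro sets.countable_INT') auto
  also have "(\<Inter>m. fst ` S m) = unbounded_sites"
  proof -
    have "fst ` S m = {p\<in>space P \<times> UNIV. \<exists>x\<in>{snd p}. \<exists>\<xi>. real m < norm \<xi> \<and> F (fst p) x \<xi> > 0}" for m
      by (force simp: S_def space_pair_measure image_iff)
    moreover have "bounded (site_territory (F (fst p)) (snd p)) \<longleftrightarrow>
        bounded (\<Union>x\<in>{snd p}. site_territory (F (fst p)) x)" for p
      by simp
    ultimately show ?thesis
      unfolding unbounded_sites_def by (simp only: not_bounded_UN_site_territory_iff) auto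
  qed
  finally show ?thesis .
qed

lemma AE_campbell:
  assumes "N \<in> null_sets (campbell k)"
  shows "AE \<omega> in P. AE x in local_kernel k \<omega>. (\<omega>, x) \<notin> N"
proof -
  have N [measurable]: "N \<in> sets (P \<Otimes>\<^sub>M borel)" using assms by auto
  have "AE p in campbell k. p \<notin> N" using assms by (rule AE_not_in)
  then have "AE \<omega> in P. AE p in distr (local_kernel k \<omega>) (P \<Otimes>\<^sub>M borel) (Pair \<omega>). p \<notin> N"
    unfolding campbell_def by (subst (asm) AE_bind[OF campbell_kernel_measurable]) measurable
  with AE_space show ?thesis
  proof eventually_elim
    case (elim \<omega>)
    have "Pair \<omega> \<in> measurable (local_kernel k \<omega>) (P \<Otimes>\<^sub>M borel)"
      using elim(1) by (simp add: measurable_cong_sets[OF sets_local_kernel[OF elim(1)] refl])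
    with elim(2) N show ?case by (subst (asm) AE_distr_iff) auto
  qed
qed

text \<open>The unbounded sites are enclosed between a measurable set \<open>S k\<close> and its
  union with a Campbell-null set. Slices of \<open>S k\<close> are Borel with mass measurable in
  \<open>\<omega>\<close>, so recurrence applies to the events that this mass exceeds a fixed
  bound.\<close>

lemma AE_bounded_site_territory:
  "AE \<omega> in P. AE x in \<Phi> \<omega>. bounded (site_territory (F \<omega>) x)"
proof -
  have "\<exists>S N. S \<in> sets (P \<Otimes>\<^sub>M borel) \<and> N \<in> null_sets (campbell k) \<and> S \<subseteq> unbounded_sites \<and>
      unbounded_sites \<subseteq> S \<union> N" for k
    using unbounded_sites_sets[of k] by (rule sets_completionE) (auto simp: sets_campbell)
  then have "\<forall>k. \<exists>S N. S \<in> sets (P \<Otimes>\<^sub>M borel) \<and> N \<in> null_sets (campbell k) \<and> S \<subseteq> unbounded_sites \<and>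
      unbounded_sites \<subseteq> S \<union> N"
    by (rule allI)
  then obtain S N where S: "\<And>k. S k \<in> sets (P \<Otimes>\<^sub>M borel)" "\<And>k. S k \<subseteq> unbounded_sites"
    and N: "\<And>k. N k \<in> null_sets (campbell k)" "\<And>k. unbounded_sites \<subseteq> S k \<union> N k"
    by metis
  have slice: "Pair \<omega> -` S k \<in> sets borel" for k \<omega>
    using sets_Pair1[OF S(1)] .
  define E where "E k j = {\<omega>\<in>space P. ennreal (1 / real (Suc j)) < emeasure (local_kernel k \<omega>) (Pair \<omega> -` S k)}" for k j
  have "E k j \<in> sets P" for k j
  proof -
    have "(SIGMA \<omega>:space P. Pair \<omega> -` S k) = S k"
      using sets.sets_into_space[OF S(1)[of k]] by (auto simp: space_pair_measure)
    then have [measurable]: "(\<lambda>\<omega>. emeasure (local_kernel k \<omega>) (Pair \<omega> -` S k)) \<in> borel_measurable P"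
      using S(1)[of k] by (intro emeasure_measurable_subprob_algebra2[OF _ local_kernel_measurable]) simp
    show ?thesis unfolding E_def by measurable
  qed
  then have "AE \<omega> in P. \<forall>k j. \<omega> \<in> E k j \<longrightarrow>
      (\<forall>v\<in>(Basis :: 'd set) \<union> uminus ` Basis. \<forall>N. \<exists>n\<ge>N. \<theta> (real n *\<^sub>R v) \<omega> \<in> E k j)"
    unfolding AE_all_countable by (intro allI recurrence)
  moreover have "AE \<omega> in P. \<forall>k. AE x in local_kernel k \<omega>. (\<omega>, x) \<notin> N k"
    unfolding AE_all_countable by (intro allI AE_campbell N)
  ultimately show ?thesis
    using AE_space
  proof eventually_elim
    case (elim \<omega>)
    note \<omega> = elim(3)
    show ?case
    proof (cases "\<exists>k j. \<omega> \<in> E k j")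
      case True
      then obtain k j where kj: "\<omega> \<in> E k j" by blast
      \<comment> \<open>Recurrence of positive mass of unbounded sites forces every territory to be
        bounded. Since the slice in question is nonempty, this case is in fact
        contradictory.\<close>
      have "bounded (site_territory (F \<omega>) x)" for x
      proof (rule bounded_site_territory[OF F_constrained F_stable sets_\<Phi>])
        show "0 < ennreal (1 / real (Suc j))" by simp
        fix v :: 'd and N0 assume "v \<in> Basis \<union> uminus ` Basis"
        with elim(1) kj obtain n where n: "n \<ge> N0" "\<theta> (real n *\<^sub>R v) \<omega> \<in> E k j" by blast
        define s where "s = real n *\<^sub>R v"
        define \<omega>' where "\<omega>' = \<theta> s \<omega>"
        have \<omega>': "\<omega>' \<in> space P" unfolding \<omega>'_def by (rule flow_in_space[OF \<omega>])
        define B where "B = Pair \<omega>' -` S k \<inter> cball 0 (real k)"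
        have B: "B \<in> sets borel" unfolding B_def by (intro sets.Int slice) simp
        \<comment> \<open>The unbounded sites seen near the origin from the shifted point,
          translated back to \<open>\<omega>\<close>; \<open>\<Phi>_shift\<close> preserves their
          mass.\<close>
        define V where "V = (\<lambda>x. x + s) ` B"
        have "V = (\<lambda>x. x - s) -` B \<inter> space borel" unfolding V_def by (force simp: image_iff)
        also have "\<dots> \<in> sets borel" using B by measurable
        finally have V: "V \<in> sets borel" .
        have "ennreal (1 / real (Suc j)) \<le> emeasure (local_kernel k \<omega>') (Pair \<omega>' -` S k)"
          using n(2) by (simp add: E_def \<omega>'_def s_def less_imp_le)
        also have "\<dots> \<le> emeasure (\<Phi> \<omega>') B"
          unfolding B_def by (rule emeasure_local_kernel_le[OF \<omega>' slice])
        also have "\<dots> = emeasure (\<Phi> \<omega>) V"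
          unfolding V_def \<omega>'_def by (rule \<Phi>_shift[OF \<omega> B])
        finally have "ennreal (1 / real (Suc j)) \<le> emeasure (\<Phi> \<omega>) V" .
        moreover have "V \<subseteq> cball s (real k)" by (auto simp: V_def B_def dist_norm)
        moreover have "V \<subseteq> {x. \<not> bounded (site_territory (F \<omega>) x)}"
        proof
          fix y assume "y \<in> V"
          then obtain x where x: "x \<in> B" "y = x + s" by (auto simp: V_def)
          then have "(\<omega>', x) \<in> unbounded_sites" using S(2) by (auto simp: B_def)
          then have "\<not> bounded ((\<lambda>\<xi>. \<xi> - s) ` site_territory (F \<omega>) (x + s))"
            by (simp add: unbounded_sites_def \<omega>'_def site_territory_shift[OF \<omega>])
          then show "y \<in> {x. \<not> bounded (site_territory (F \<omega>) x)}"
            using bounded_translation_minus[of "site_territory (F \<omega>) y" s] x(2) by auto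
        qed
        ultimately show "\<exists>n\<ge>N0. \<exists>V\<in>sets borel. V \<subseteq> cball (real n *\<^sub>R v) (real k) \<and>
            V \<subseteq> {x. \<not> bounded (site_territory (F \<omega>) x)} \<and> ennreal (1 / real (Suc j)) \<le> emeasure (\<Phi> \<omega>) V"
          using n(1) V unfolding s_def by blast
      qed (rule \<omega>)+
      then show ?thesis by simp
    next
      case False
      have "AE x in local_kernel k \<omega>. bounded (site_territory (F \<omega>) x)" for k
      proof -
        have "emeasure (local_kernel k \<omega>) (Pair \<omega> -` S k) \<le> 0"
        proof (rule ennreal_le_epsilon)
          fix e :: real assume "0 < e"
          then obtain j where j: "1 / real (Suc j) < e" by (rule nat_approx_posE)
          have "emeasure (local_kernel k \<omega>) (Pair \<omega> -` S k) \<le> ennreal (1 / real (Suc j))"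
            using False \<omega> by (auto simp: E_def not_less)
          also have "\<dots> \<le> 0 + ennreal e" using j by (simp add: ennreal_leI)
          finally show "emeasure (local_kernel k \<omega>) (Pair \<omega> -` S k) \<le> 0 + ennreal e" .
        qed
        then have "Pair \<omega> -` S k \<in> null_sets (local_kernel k \<omega>)"
          using slice \<omega> by (intro null_setsI) auto
        from AE_not_in[OF this] spec[OF elim(2), of k] show ?thesis
        proof eventually_elim
          case (elim x)
          then have "(\<omega>, x) \<notin> unbounded_sites" using N(2)[of k] by auto
          with \<omega> show ?case by (simp add: unbounded_sites_def)
        qed
      qed
      \<comment> \<open>Countably many balls cover the space, so the local statements
        combine.\<close>
      then have "AE x in \<Phi> \<omega>. \<forall>k::nat. x \<in> cball 0 (real k) \<longrightarrow> bounded (site_territory (F \<omega>) x)"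
        unfolding AE_all_countable AE_local_kernel_iff[OF \<omega>] by (rule allI)
      then show ?thesis
      proof eventually_elim
        case (elim x)
        obtain k :: nat where "norm x \<le> real k" using real_arch_simple by blast
        with elim show ?case by auto
      qed
    qed
  qed
qed

end


section \<open>Exchange of sites and centers\<close>

text \<open>Exchanging the arguments of \<open>F\<close> turns exhausted sites into sated centers
  and exchanges the two desire relations, so stability is preserved by symmetry of the
  distance.\<close>

lemma stable_transport_swap:
  assumes "stable_transport P \<theta> \<Phi> \<Psi> F"
  shows "stable_transport P \<theta> \<Psi> \<Phi> (\<lambda>\<omega> x y. F \<omega> y x)"
proof -
  interpret stable_transport P \<theta> \<Phi> \<Psi> F by fact
  have swap: "constrained_density \<psi> \<phi> (\<lambda>x y. f y x)"
    if "constrained_density \<phi> \<psi> f" for \<phi> \<psi> and f :: "'b \<Rightarrow> 'b \<Rightarrow> real"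
  proof -
    have "(\<lambda>(x, y). f x y) \<in> borel_measurable (borel \<Otimes>\<^sub>M borel)"
      using that by (simp add: constrained_density_def)
    from measurable_pair_swap[OF this] that show ?thesis
      by (simp add: constrained_density_def)
  qed
  show ?thesis
  proof
    have "(\<lambda>p. case (fst p, snd (snd p), fst (snd p)) of (\<omega>, x, y) \<Rightarrow> F \<omega> x y)
        \<in> borel_measurable (P \<Otimes>\<^sub>M (borel \<Otimes>\<^sub>M borel))"
      by (rule measurable_compose[OF _ F_measurable]) measurable
    then show "(\<lambda>(\<omega>, x, y). F \<omega> y x) \<in> borel_measurable (P \<Otimes>\<^sub>M (borel \<Otimes>\<^sub>M borel))"
      by (simp add: case_prod_beta)
    show "stable (\<Psi> \<omega>) (\<Phi> \<omega>) (\<lambda>x y. F \<omega> y x)" if "\<omega> \<in> space P" for \<omega>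
      using F_stable[OF that]
      unfolding stable_def site_desires_def center_desires_def exhausted_def sated_def
      by (metis dist_commute)
  qed (fact flow \<Phi> \<Psi> | simp add: F_shift F_constrained swap)+
qed

theorem mainTheorem14:
  fixes P :: "'w measure"
    and \<theta> :: "'d::euclidean_space \<Rightarrow> 'w \<Rightarrow> 'w"
    and \<Phi> \<Psi> :: "'w \<Rightarrow> 'd measure"
    and F :: "'w \<Rightarrow> 'd \<Rightarrow> 'd \<Rightarrow> real"
  assumes "prob_space P"
    and "measurable_flow P \<theta>"
    and "stationary_random_measure P \<theta> \<Phi>"
    and "stationary_random_measure P \<theta> \<Psi>"
    and "AE \<omega> in P. emeasure (\<Phi> \<omega>) UNIV \<noteq> 0"
    and "AE \<omega> in P. emeasure (\<Psi> \<omega>) UNIV \<noteq> 0"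
    and "finite_intensity P \<Phi>"
    and "finite_intensity P \<Psi>"
    and "(\<lambda>(\<omega>, x, y). F \<omega> x y) \<in> borel_measurable (P \<Otimes>\<^sub>M (borel \<Otimes>\<^sub>M borel))"
    and "\<forall>\<omega>\<in>space P. \<forall>x y. F \<omega> x y \<ge> 0"
    and "\<forall>s. \<forall>\<omega>\<in>space P. \<forall>x y. F (\<theta> s \<omega>) x y = F \<omega> (x + s) (y + s)"
    and "\<forall>\<omega>\<in>space P. constrained_density (\<Phi> \<omega>) (\<Psi> \<omega>) (F \<omega>) \<and> stable (\<Phi> \<omega>) (\<Psi> \<omega>) (F \<omega>)"
  shows "AE \<omega> in P.
           (AE x in \<Phi> \<omega>. bounded (site_territory (F \<omega>) x)) \<and>
           (AE \<xi> in \<Psi> \<omega>. bounded (center_territory (F \<omega>) \<xi>)) \<and>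
           (\<forall>K. bounded K \<longrightarrow>
              finite_outer (\<Psi> \<omega>) (\<Union>x\<in>K. site_territory (F \<omega>) x) \<and>
              finite_outer (\<Phi> \<omega>) (\<Union>\<xi>\<in>K. center_territory (F \<omega>) \<xi>))"
proof -
  interpret prob_space P by fact
  interpret sites: stable_transport P \<theta> \<Phi> \<Psi> F
    by standard (use assms in blast)+
  interpret centers: stable_transport P \<theta> \<Psi> \<Phi> "\<lambda>\<omega> x y. F \<omega> y x"
    by (rule stable_transport_swap) (rule sites.stable_transport_axioms)
  have swap: "site_territory (\<lambda>x y. F \<omega> y x) = center_territory (F \<omega>)" for \<omega>
    by (simp add: fun_eq_iff site_territory_def center_territory_def)
  show ?thesis
    using sites.AE_bounded_site_territory sites.AE_finite_outer_UN_site_territory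
      centers.AE_bounded_site_territory[unfolded swap]
      centers.AE_finite_outer_UN_site_territory[unfolded swap]
    by eventually_elim blast
qed

end
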